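(* Let $G$ be a graph that is not bipartite. Then the category $\mathbf{Gra}\to G$ is algebraically universal.
   Context: Graphs are undirected graphs without loops; a graph homomorphism $f:G\to H$ is a map on vertices with $(u,v)\in E(G)\Rightarrow (f(u),f(v))\in E(H)$. $\mathbf{Gra}\to G$ denotes the full subcategory of the category of graphs and graph homomorphisms consisting of those graphs that admit a homomorphism to $G$. A category is algebraic if it is isomorphic to a full subcategory of the category of universal algebras of some type with all homomorphisms; a category $\mathfrak{C}$ is algebraically universal if every algebraic category admits a full embedding into $\mathfrak{C}$. *)

theory Defs
  imports Main "HOL-Library.FuncSet"
begin

unbundle cardinal_syntax

section \<open>Small sets\<close>

text \<open>
  An infinite type \<open>'u\<close> plays the role of the class of all sets. As in von Neumann's axiom of
  limitation of size, a subset of \<open>'u\<close> counts as a set (is small) iff it is not equinumerous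
  with the whole of \<open>'u\<close>; the objects of the large categories below have small underlying sets.
  If the cardinality of \<open>'u\<close> is strongly inaccessible, this is the usual category theory inside a
  Grothendieck universe; if \<open>'u\<close> is countable, the small sets are the finite sets; if the
  cardinality of \<open>'u\<close> is the successor of \<open>\<kappa>\<close>, they are the sets of size at most \<open>\<kappa>\<close>.
\<close>

definition small :: "'u set \<Rightarrow> bool" where
  "small A \<longleftrightarrow> |A| <o |UNIV :: 'u set|"


section \<open>Categories\<close>

text \<open>
  Hom-sets need not be disjoint, so composition takes the three objects as arguments:
  \<open>Comp C a b c g f\<close> is \<open>g \<circ> f\<close> for \<open>f : a \<rightarrow> b\<close> and \<open>g : b \<rightarrow> c\<close>.
  For the same reason the morphism part of a functor takes source and target as arguments.
\<close>

record ('o, 'm) category =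
  Obj :: "'o set"
  Hom :: "'o \<Rightarrow> 'o \<Rightarrow> 'm set"
  Comp :: "'o \<Rightarrow> 'o \<Rightarrow> 'o \<Rightarrow> 'm \<Rightarrow> 'm \<Rightarrow> 'm"
  Id :: "'o \<Rightarrow> 'm"

locale category =
  fixes C :: "('o, 'm) category"
  assumes Id_in_Hom: "a \<in> Obj C \<Longrightarrow> Id C a \<in> Hom C a a"
    and Comp_in_Hom:
      "\<lbrakk>a \<in> Obj C; b \<in> Obj C; c \<in> Obj C; f \<in> Hom C a b; g \<in> Hom C b c\<rbrakk>
        \<Longrightarrow> Comp C a b c g f \<in> Hom C a c"
    and Comp_Id_right:
      "\<lbrakk>a \<in> Obj C; b \<in> Obj C; f \<in> Hom C a b\<rbrakk> \<Longrightarrow> Comp C a a b f (Id C a) = f"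
    and Comp_Id_left:
      "\<lbrakk>a \<in> Obj C; b \<in> Obj C; f \<in> Hom C a b\<rbrakk> \<Longrightarrow> Comp C a b b (Id C b) f = f"
    and Comp_assoc:
      "\<lbrakk>a \<in> Obj C; b \<in> Obj C; c \<in> Obj C; d \<in> Obj C;
        f \<in> Hom C a b; g \<in> Hom C b c; h \<in> Hom C c d\<rbrakk>
        \<Longrightarrow> Comp C a c d h (Comp C a b c g f) = Comp C a b d (Comp C b c d h g) f"

locale category_functor = C: category C + D: category D
  for C :: "('o, 'm) category" and D :: "('p, 'n) category" +
  fixes F :: "'o \<Rightarrow> 'p" and F' :: "'o \<Rightarrow> 'o \<Rightarrow> 'm \<Rightarrow> 'n"
  assumes F_Obj: "a \<in> Obj C \<Longrightarrow> F a \<in> Obj D"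
    and F'_Hom:
      "\<lbrakk>a \<in> Obj C; b \<in> Obj C; f \<in> Hom C a b\<rbrakk> \<Longrightarrow> F' a b f \<in> Hom D (F a) (F b)"
    and F'_Id: "a \<in> Obj C \<Longrightarrow> F' a a (Id C a) = Id D (F a)"
    and F'_Comp:
      "\<lbrakk>a \<in> Obj C; b \<in> Obj C; c \<in> Obj C; f \<in> Hom C a b; g \<in> Hom C b c\<rbrakk>
        \<Longrightarrow> F' a c (Comp C a b c g f) = Comp D (F a) (F b) (F c) (F' b c g) (F' a b f)"

text \<open>A full embedding is a full and faithful functor that is injective on objects.\<close>

definition full_embedding ::
  "('o, 'm) category \<Rightarrow> ('p, 'n) category \<Rightarrow> ('o \<Rightarrow> 'p) \<Rightarrow> ('o \<Rightarrow> 'o \<Rightarrow> 'm \<Rightarrow> 'n) \<Rightarrow> bool" where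
  "full_embedding C D F F' \<longleftrightarrow>
     category_functor C D F F' \<and> inj_on F (Obj C) \<and>
     (\<forall>a\<in>Obj C. \<forall>b\<in>Obj C. inj_on (F' a b) (Hom C a b)) \<and>
     (\<forall>a\<in>Obj C. \<forall>b\<in>Obj C. F' a b ` Hom C a b = Hom D (F a) (F b))"

definition isomorphic_categories :: "('o, 'm) category \<Rightarrow> ('p, 'n) category \<Rightarrow> bool" where
  "isomorphic_categories C D \<longleftrightarrow>
     (\<exists>F F'. category_functor C D F F' \<and> bij_betw F (Obj C) (Obj D) \<and>
       (\<forall>a\<in>Obj C. \<forall>b\<in>Obj C. bij_betw (F' a b) (Hom C a b) (Hom D (F a) (F b))))"

definition full_subcategory :: "('o, 'm) category \<Rightarrow> 'o set \<Rightarrow> ('o, 'm) category" where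
  "full_subcategory C S = C\<lparr>Obj := S\<rparr>"

lemma category_full_subcategory:
  assumes "category C" "S \<subseteq> Obj C"
  shows "category (full_subcategory C S)"
proof -
  interpret category C by fact
  have S: "a \<in> Obj C" if "a \<in> S" for a using that assms(2) by blast
  show ?thesis
    by unfold_locales
      (simp_all add: full_subcategory_def S Id_in_Hom Comp_in_Hom Comp_Id_right Comp_Id_left
        Comp_assoc)
qed


section \<open>Universal algebras\<close>

text \<open>
  A type consists of operation symbols and, for each of them, an arity. Arities are sets, not
  necessarily finite: an operation of arity \<open>I\<close> on \<open>A\<close> maps \<open>I\<close>-indexed families in \<open>A\<close> to \<open>A\<close>,
  so the ordinary \<open>n\<close>-ary operations are those whose arity is a set with \<open>n\<close> elements.
\<close>

record 'u algebra_type =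
  symbols :: "'u set"
  arity :: "'u \<Rightarrow> 'u set"

text \<open>
  The third condition says that the families to which the operations apply form a set. In set
  theory this always holds. Here it is automatic whenever all arities are finite
  (\<open>finitary_algebra_type\<close>) or the small sets form a Grothendieck universe
  (\<open>inaccessible_algebra_type\<close>); it only matters for infinite arities when the power set of a
  small set need not be small.
\<close>

definition algebra_type :: "'u algebra_type \<Rightarrow> bool" where
  "algebra_type \<Delta> \<longleftrightarrow>
     small (symbols \<Delta>) \<and> (\<forall>s\<in>symbols \<Delta>. small (arity \<Delta> s)) \<and>
     (\<forall>A::'u set. small A \<longrightarrow> |SIGMA s:symbols \<Delta>. arity \<Delta> s \<rightarrow>\<^sub>E A| <o |UNIV :: 'u set| )"

record 'u algebra =
  carrier :: "'u set"
  operation :: "'u \<Rightarrow> ('u \<Rightarrow> 'u) \<Rightarrow> 'u"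

text \<open>
  Operations and morphisms are extensional (undefined outside their domain), so that equality
  of algebras and of morphisms in HOL is the intended equality.
\<close>

definition algebra :: "'u algebra_type \<Rightarrow> 'u algebra \<Rightarrow> bool" where
  "algebra \<Delta> A \<longleftrightarrow>
     operation A \<in> (\<Pi>\<^sub>E s\<in>symbols \<Delta>. (arity \<Delta> s \<rightarrow>\<^sub>E carrier A) \<rightarrow>\<^sub>E carrier A)"

definition algebra_homs ::
  "'u algebra_type \<Rightarrow> 'u algebra \<Rightarrow> 'u algebra \<Rightarrow> ('u \<Rightarrow> 'u) set" where
  "algebra_homs \<Delta> A B =
     {h \<in> carrier A \<rightarrow>\<^sub>E carrier B.
        \<forall>s\<in>symbols \<Delta>. \<forall>x\<in>arity \<Delta> s \<rightarrow>\<^sub>E carrier A.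
          h (operation A s x) = operation B s (compose (arity \<Delta> s) h x)}"

definition Alg :: "'u algebra_type \<Rightarrow> ('u algebra, 'u \<Rightarrow> 'u) category" where
  "Alg \<Delta> =
     \<lparr>Obj = {A. algebra \<Delta> A \<and> small (carrier A)},
      Hom = algebra_homs \<Delta>,
      Comp = (\<lambda>A B C g f. compose (carrier A) g f),
      Id = (\<lambda>A. \<lambda>x\<in>carrier A. x)\<rparr>"

text \<open>
  The first argument fixes the type \<open>'u\<close> of sets from which the algebras are built; the objects
  and morphisms of an algebraic category may belong to any types.
\<close>

definition algebraic_category :: "'u itself \<Rightarrow> ('o, 'm) category \<Rightarrow> bool" where
  "algebraic_category TYPE('u) C \<longleftrightarrow>
     category C \<and>
     (\<exists>(\<Delta>::'u algebra_type) S. algebra_type \<Delta> \<and> S \<subseteq> Obj (Alg \<Delta>) \<and>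
        isomorphic_categories C (full_subcategory (Alg \<Delta>) S))"

text \<open>
  HOL cannot quantify over types inside a definition, so the types of objects and morphisms of
  the algebraic categories to be embedded are passed as arguments; a statement with \<open>'o\<close> and
  \<open>'m\<close> free speaks about all algebraic categories.
\<close>

definition algebraically_universal ::
  "'u itself \<Rightarrow> 'o itself \<Rightarrow> 'm itself \<Rightarrow> ('p, 'n) category \<Rightarrow> bool" where
  "algebraically_universal TYPE('u) TYPE('o) TYPE('m) D \<longleftrightarrow>
     category D \<and>
     (\<forall>C::('o, 'm) category. algebraic_category TYPE('u) C \<longrightarrow>
        (\<exists>F F'. full_embedding C D F F'))"

lemma category_Alg: "category (Alg \<Delta>)"
proof
  fix A B C f g
  assume *: "A \<in> Obj (Alg \<Delta>)" "B \<in> Obj (Alg \<Delta>)" "C \<in> Obj (Alg \<Delta>)"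
    "f \<in> Hom (Alg \<Delta>) A B" "g \<in> Hom (Alg \<Delta>) B C"
  have f: "f \<in> carrier A \<rightarrow>\<^sub>E carrier B" and g: "g \<in> carrier B \<rightarrow>\<^sub>E carrier C"
    using * by (auto simp: Alg_def algebra_homs_def)
  have "compose (carrier A) g f (operation A s x)
      = operation C s (compose (arity \<Delta> s) (compose (carrier A) g f) x)"
    if s: "s \<in> symbols \<Delta>" and x: "x \<in> arity \<Delta> s \<rightarrow>\<^sub>E carrier A" for s x
  proof -
    have "operation A s x \<in> carrier A"
      using *(1) s x by (auto simp: Alg_def algebra_def PiE_iff)
    moreover have fx: "compose (arity \<Delta> s) f x \<in> arity \<Delta> s \<rightarrow>\<^sub>E carrier B"
      using f x by (auto simp: compose_def PiE_iff)
    moreover have "compose (arity \<Delta> s) g (compose (arity \<Delta> s) f x)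
        = compose (arity \<Delta> s) (compose (carrier A) g f) x"
      using x by (auto simp: compose_def PiE_iff fun_eq_iff)
    ultimately show ?thesis
      using * s x fx by (simp add: Alg_def algebra_homs_def compose_eq)
  qed
  then show "Comp (Alg \<Delta>) A B C g f \<in> Hom (Alg \<Delta>) A C"
    using f g by (auto simp: Alg_def algebra_homs_def compose_def PiE_iff)
next
  fix A assume A: "A \<in> Obj (Alg \<Delta>)"
  have "operation A s x \<in> carrier A" and "compose (arity \<Delta> s) (\<lambda>x\<in>carrier A. x) x = x"
    if "s \<in> symbols \<Delta>" "x \<in> arity \<Delta> s \<rightarrow>\<^sub>E carrier A" for s x
    using A that by (auto simp: Alg_def algebra_def PiE_iff compose_def fun_eq_iff
        extensional_def)
  then show "Id (Alg \<Delta>) A \<in> Hom (Alg \<Delta>) A A"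
    by (auto simp: Alg_def algebra_homs_def)
qed (auto simp: Alg_def algebra_homs_def compose_def PiE_iff fun_eq_iff extensional_def)

lemma finite_PiE_card_of:
  assumes "finite I" "infinite B"
  shows "|I \<rightarrow>\<^sub>E B| \<le>o |B|"
  using assms(1)
proof induction
  case empty
  have "B \<noteq> {}" using assms(2) by auto
  then show ?case by (simp add: card_of_singl_ordLeq)
next
  case (insert i I)
  have "|insert i I \<rightarrow>\<^sub>E B| \<le>o |B \<times> (I \<rightarrow>\<^sub>E B)|"
    unfolding PiE_insert_eq by (rule card_of_image)
  also have "|B \<times> (I \<rightarrow>\<^sub>E B)| \<le>o |B|"
    by (rule card_of_Sigma_ordLeq_infinite[OF assms(2)])
      (simp_all add: insert.IH card_of_refl ordIso_imp_ordLeq)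
  finally show ?case .
qed

lemma finitary_algebra_type:
  fixes \<Delta> :: "'u algebra_type"
  assumes inf: "infinite (UNIV :: 'u set)"
    and symbols: "small (symbols \<Delta>)"
    and finite: "\<forall>s\<in>symbols \<Delta>. finite (arity \<Delta> s)"
  shows "algebra_type \<Delta>"
proof -
  have fin_small: "|X| <o |UNIV :: 'u set|" if "finite X" for X :: "'x set"
    using that inf by (meson card_of_ordLeq_finite card_of_Well_order not_ordLeq_iff_ordLess)
  have "|SIGMA s:symbols \<Delta>. arity \<Delta> s \<rightarrow>\<^sub>E A| <o |UNIV :: 'u set|" if A: "small A" for A :: "'u set"
  proof (cases "finite (symbols \<Delta>) \<and> finite A")
    case True
    then show ?thesis
      using finite by (intro fin_small finite_SigmaI finite_PiE) auto
  next
    case False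
    define B where "B = symbols \<Delta> \<union> A"
    have B: "infinite B" "|B| <o |UNIV :: 'u set|"
      using False A symbols card_of_Un_ordLess_infinite[OF inf]
      by (auto simp: B_def small_def)
    have "|arity \<Delta> s \<rightarrow>\<^sub>E A| \<le>o |B|" if "s \<in> symbols \<Delta>" for s
    proof -
      have "|arity \<Delta> s \<rightarrow>\<^sub>E A| \<le>o |arity \<Delta> s \<rightarrow>\<^sub>E B|"
        by (rule card_of_mono1) (auto simp: B_def PiE_iff)
      also have "|arity \<Delta> s \<rightarrow>\<^sub>E B| \<le>o |B|"
        using that finite B(1) by (intro finite_PiE_card_of) auto
      finally show ?thesis .
    qed
    then have "|SIGMA s:symbols \<Delta>. arity \<Delta> s \<rightarrow>\<^sub>E A| \<le>o |B|"
      by (intro card_of_Sigma_ordLeq_infinite[OF B(1)]) (auto simp: B_def intro: card_of_mono1)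
    then show ?thesis using B(2) by (rule ordLeq_ordLess_trans)
  qed
  then show ?thesis
    using symbols finite by (auto simp: algebra_type_def small_def fin_small)
qed

lemma inaccessible_algebra_type:
  fixes \<Delta> :: "'u algebra_type"
  assumes inf: "infinite (UNIV :: 'u set)"
    and regular: "regularCard |UNIV :: 'u set|"
    and strong_limit: "\<And>A :: 'u set. small A \<Longrightarrow> |Pow A| <o |UNIV :: 'u set|"
    and symbols: "small (symbols \<Delta>)"
    and small_arity: "\<forall>s\<in>symbols \<Delta>. small (arity \<Delta> s)"
  shows "algebra_type \<Delta>"
proof -
  have stable: "stable |UNIV :: 'u set|"
    using inf regular by (intro regularCard_stable) (auto simp: Field_card_of card_of_card_order_on)
  have "|I \<rightarrow>\<^sub>E A| <o |UNIV :: 'u set|" if I: "small I" and A: "small A" for I A :: "'u set"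
  proof -
    have IA: "|I \<times> A| <o |UNIV :: 'u set|"
      using I A by (auto simp: small_def intro: stable_elim[OF stable])
    then obtain e :: "'u \<times> 'u \<Rightarrow> 'u" where e: "inj_on e (I \<times> A)"
      by (meson card_of_ordLeq ordLess_imp_ordLeq)
    have "|e ` (I \<times> A)| <o |UNIV :: 'u set|"
      using card_of_image IA by (rule ordLeq_ordLess_trans)
    then have *: "|Pow (e ` (I \<times> A))| <o |UNIV :: 'u set|"
      by (intro strong_limit) (simp add: small_def)
    define G where "G x = e ` {(i, x i) | i. i \<in> I}" for x :: "'u \<Rightarrow> 'u"
    have "inj_on G (I \<rightarrow>\<^sub>E A)"
    proof (rule inj_onI)
      fix x y assume x: "x \<in> I \<rightarrow>\<^sub>E A" and y: "y \<in> I \<rightarrow>\<^sub>E A" and "G x = G y"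
      then have "{(i, x i) | i. i \<in> I} = {(i, y i) | i. i \<in> I}"
        unfolding G_def by (subst (asm) inj_on_image_eq_iff[OF e]) auto
      then show "x = y" using x y by (intro PiE_ext) (auto simp: set_eq_iff)
    qed
    moreover have "G ` (I \<rightarrow>\<^sub>E A) \<subseteq> Pow (e ` (I \<times> A))"
      by (auto simp: G_def)
    ultimately have "|I \<rightarrow>\<^sub>E A| \<le>o |Pow (e ` (I \<times> A))|"
      using card_of_ordLeq by blast
    then show ?thesis using * by (rule ordLeq_ordLess_trans)
  qed
  then show ?thesis
    using symbols small_arity
    by (auto simp: algebra_type_def small_def intro!: stable_elim[OF stable])
qed


section \<open>Graphs\<close>

text \<open>An undirected edge is represented by both of its orientations.\<close>

record 'v graph =
  verts :: "'v set"
  edges :: "('v \<times> 'v) set"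

definition graph :: "'v graph \<Rightarrow> bool" where
  "graph G \<longleftrightarrow> edges G \<subseteq> verts G \<times> verts G \<and> sym (edges G) \<and> irrefl (edges G)"

definition graph_homs :: "'v graph \<Rightarrow> 'w graph \<Rightarrow> ('v \<Rightarrow> 'w) set" where
  "graph_homs G H =
     {f \<in> verts G \<rightarrow>\<^sub>E verts H. \<forall>u v. (u, v) \<in> edges G \<longrightarrow> (f u, f v) \<in> edges H}"

definition bipartite :: "'v graph \<Rightarrow> bool" where
  "bipartite G \<longleftrightarrow>
     (\<exists>X Y. X \<union> Y = verts G \<and> X \<inter> Y = {} \<and> edges G \<subseteq> X \<times> Y \<union> Y \<times> X)"

definition Gra :: "('u graph, 'u \<Rightarrow> 'u) category" where
  "Gra =
     \<lparr>Obj = {H. graph H \<and> small (verts H)},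
      Hom = graph_homs,
      Comp = (\<lambda>G H K g f. compose (verts G) g f),
      Id = (\<lambda>G. \<lambda>x\<in>verts G. x)\<rparr>"

definition Gra_to :: "'v graph \<Rightarrow> ('u graph, 'u \<Rightarrow> 'u) category" where
  "Gra_to G = full_subcategory Gra {H \<in> Obj Gra. graph_homs H G \<noteq> {}}"

lemma category_Gra: "category Gra"
proof
  fix G H K :: "'a graph" and f g
  assume *: "G \<in> Obj Gra" "f \<in> Hom Gra G H" "g \<in> Hom Gra H K"
  then have "u \<in> verts G" "v \<in> verts G" if "(u, v) \<in> edges G" for u v
    using that by (auto simp: Gra_def graph_def)
  with * show "Comp Gra G H K g f \<in> Hom Gra G K"
    by (auto simp: Gra_def graph_homs_def PiE_iff compose_def)
qed (auto simp: Gra_def graph_def graph_homs_def compose_def PiE_iff fun_eq_iff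
    extensional_def)

lemma category_Gra_to: "category (Gra_to G)"
  unfolding Gra_to_def by (rule category_full_subcategory[OF category_Gra]) auto

end

theory Submission
  imports Defs
begin

text \<open>
  A non-bipartite graph \<open>G\<close> has a closed walk of odd length \<open>d = 2 r + 1\<close>, so every graph in which each
  edge has been subdivided into a path of length \<open>d\<close> admits a homomorphism to \<open>G\<close>. If every edge of
  \<open>X\<close> lies in a \<open>K\<^sub>4\<close>, subdividing loses nothing: odd closed walks in a subdivision have length at
  least \<open>3 d\<close>, which forces homomorphisms between subdivisions to map branch vertices to branch
  vertices. It thus remains to embed algebras into plain graphs whose edges lie in \<open>K\<^sub>4\<close>'s.

  An algebra is a set of tuples: the term \<open>t = s(x)\<close>, the entry \<open>x i\<close> or the value of \<open>t\<close>, and a label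
  \<open>(s, i)\<close> or \<open>s\<close>. The labels must be fixed by all homomorphisms; this is achieved, following
  Vopenka, Pultr and Hedrlin, by a well-ordering together with a cofinal \<open>\<omega>\<close>-sequence for each
  limit of cofinality \<open>\<omega>\<close>. Finally each tuple is replaced by a copy of one finite rigid graph, whose
  independent vertices serve as the positions of the tuples.
\<close>

section \<open>Subdivisions\<close>

text \<open>\<open>G\<close> matters only through the length \<open>d\<close>: homomorphisms to
  \<open>G\<close> come for free, and the work lies in allowing no more homomorphisms between the
  constructed graphs than between the algebras. Arities may be infinite while a gadget has finitely
  many positions, so every family of arguments becomes an element \<open>Term\<close> of its own,
  tied to its entries one index at a time. Labels that could move would let these indices be
  confused. A well-ordering alone does not pin them: on the natural numbers, doubling is strictly
  increasing and fixes 0. The cofinal sequences exclude such maps because they relate consecutive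
  members to the limit itself. Size is the second obstacle, since the power set of a small set need
  not be small here: the bounds rest on the condition on \<open>\<Delta>\<close> that argument
  families over a small set form a small set, and on each tuple costing only finitely many
  vertices.\<close>

text \<open>
  \<open>pt r x y i\<close> is the \<open>i\<close>-th vertex on the path from \<open>x\<close> to \<open>y\<close>. As the length \<open>2 r + 1\<close> is odd, each
  inner vertex has a nearer end, and \<open>(x, y, i)\<close> is the one at distance \<open>i\<close> from its nearer end \<open>x\<close>;
  so both orientations of an edge share one representation.
\<close>

definition pt :: "nat \<Rightarrow> 'a \<Rightarrow> 'a \<Rightarrow> nat \<Rightarrow> 'a \<times> 'a \<times> nat" where
  "pt r x y i = (if i = 0 then (x, x, 0) else if i \<le> r then (x, y, i)
     else if i < 2 * r + 1 then (y, x, 2 * r + 1 - i) else (y, y, 0))"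

definition subdivision :: "nat \<Rightarrow> 'a graph \<Rightarrow> ('a \<times> 'a \<times> nat) graph" where
  "subdivision r X =
     \<lparr>verts = (\<lambda>x. (x, x, 0)) ` verts X \<union> {pt r x y i | x y i. (x, y) \<in> edges X \<and> i \<le> 2 * r + 1},
      edges = {(pt r x y i, pt r x y (Suc i)) | x y i. (x, y) \<in> edges X \<and> i < 2 * r + 1}\<rparr>"

text \<open>The first condition excludes isolated vertices, whose images no walk could
  control.\<close>

definition K4_covered :: "'a graph \<Rightarrow> bool" where
  "K4_covered X \<longleftrightarrow> verts X \<subseteq> Domain (edges X) \<and>
     (\<forall>x y. (x, y) \<in> edges X \<longrightarrow> (\<exists>z w. {(x, z), (x, w), (y, z), (y, w), (z, w)} \<subseteq> edges X))"

lemma K4_coveredE: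
  assumes "K4_covered X" "(x, y) \<in> edges X"
  obtains z w where "{(x, z), (x, w), (y, z), (y, w), (z, w)} \<subseteq> edges X"
  using assms unfolding K4_covered_def by metis

lemma pt_0 [simp]: "pt r x y 0 = (x, x, 0)"
  by (simp add: pt_def)

lemma pt_end [simp]: "pt r x y (Suc (2 * r)) = (y, y, 0)"
  by (simp add: pt_def)

lemma pt_swap: "i \<le> 2 * r + 1 \<Longrightarrow> pt r x y i = pt r y x (2 * r + 1 - i)"
  by (auto simp: pt_def)

text \<open>An inner vertex stores its nearer end first, so it determines its edge; only the
  orientation in which the edge is read remains free.\<close>

lemma pt_eq_interior:
  assumes "pt r x y i = pt r x' y' j" "x \<noteq> y" "x' \<noteq> y'" "0 < i" "i < 2 * r + 1" "j \<le> 2 * r + 1"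
  shows "x = x' \<and> y = y' \<and> i = j \<or> x = y' \<and> y = x' \<and> i + j = 2 * r + 1"
  using assms by (auto simp: pt_def split: if_splits)

lemma pt_eq_branch:
  assumes "pt r x y i = (a, a, 0)" "x \<noteq> y" "i \<le> 2 * r + 1"
  shows "i = 0 \<and> x = a \<or> i = 2 * r + 1 \<and> y = a"
  using assms by (auto simp: pt_def split: if_splits)

lemma relpow_symmetric: "sym R \<Longrightarrow> (x, y) \<in> R ^^ n \<Longrightarrow> (y, x) \<in> R ^^ n"
proof (induction n arbitrary: x y)
  case (Suc n)
  then obtain z where "(x, z) \<in> R ^^ n" "(z, y) \<in> R" by auto
  with Suc have "(y, z) \<in> R" "(z, x) \<in> R ^^ n" by (auto dest: symD)
  then show ?case by (rule relpow_Suc_I2)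
qed auto

lemma relpow_of_walk:
  assumes "\<And>k. i \<le> k \<Longrightarrow> k < j \<Longrightarrow> (w k, w (Suc k)) \<in> R" and "i \<le> j"
  shows "(w i, w j) \<in> R ^^ (j - i)"
  unfolding relpow_fun_conv using assms
  by (intro exI[of _ "\<lambda>k. w (i + k)"]) auto

lemma relpow_hom:
  assumes "(x, y) \<in> R ^^ n" and "\<And>a b. (a, b) \<in> R \<Longrightarrow> (f a, f b) \<in> S"
  shows "(f x, f y) \<in> S ^^ n"
  using assms by (induction n arbitrary: y) auto

lemma edges_subdivisionI:
  "(x, y) \<in> edges X \<Longrightarrow> i < 2 * r + 1 \<Longrightarrow>
    (pt r x y i, pt r x y (Suc i)) \<in> edges (subdivision r X)"
  by (auto simp: subdivision_def)

lemma pt_in_verts: "(x, y) \<in> edges X \<Longrightarrow> i \<le> 2 * r + 1 \<Longrightarrow> pt r x y i \<in> verts (subdivision r X)"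
  by (auto simp: subdivision_def)

lemma graph_homs_edge: "F \<in> graph_homs X Y \<Longrightarrow> (u, v) \<in> edges X \<Longrightarrow> (F u, F v) \<in> edges Y"
  by (auto simp: graph_homs_def)

context
  fixes r :: nat and X :: "'a graph"
  assumes graph_X: "graph X"
begin

private abbreviation "d \<equiv> 2 * r + 1"
private abbreviation "E \<equiv> edges (subdivision r X)"

lemma edge_distinct: "(x, y) \<in> edges X \<Longrightarrow> x \<noteq> y"
  using graph_X by (auto simp: graph_def irrefl_def)

lemma edge_sym: "(x, y) \<in> edges X \<Longrightarrow> (y, x) \<in> edges X"
  using graph_X by (auto simp: graph_def sym_def)

lemma edge_verts: "(x, y) \<in> edges X \<Longrightarrow> x \<in> verts X \<and> y \<in> verts X"
  using graph_X by (auto simp: graph_def)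

lemma sym_subdivision: "sym E"
proof (rule symI)
  fix p q assume "(p, q) \<in> E"
  then obtain x y i where *: "(x, y) \<in> edges X" "i < d" "p = pt r x y i" "q = pt r x y (Suc i)"
    by (auto simp: subdivision_def)
  then have "p = pt r y x (Suc (d - Suc i))" "q = pt r y x (d - Suc i)"
    using pt_swap[of i r x y] pt_swap[of "Suc i" r x y] Suc_diff_Suc[of i d] by auto
  then show "(q, p) \<in> E"
    using edges_subdivisionI[OF edge_sym[OF *(1)], of "d - Suc i"] * by auto
qed

text \<open>Inner vertices have degree two: any edge at such a vertex comes from the same path, read
  forwards or backwards.\<close>

lemma neighbour_interior:
  assumes xy: "(x, y) \<in> edges X" and i: "0 < i" "i < d" and E: "(pt r x y i, q) \<in> E"
  shows "q = pt r x y (i - 1) \<or> q = pt r x y (i + 1)"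
proof -
  obtain x' y' j where *: "(x', y') \<in> edges X" "j < d" "pt r x y i = pt r x' y' j" "q = pt r x' y' (Suc j)"
    using E by (auto simp: subdivision_def)
  from pt_eq_interior[OF *(3) edge_distinct[OF xy] edge_distinct[OF *(1)] i] *(2)
  consider "x = x'" "y = y'" "i = j" | "x = y'" "y = x'" "i + j = d" by auto
  then show ?thesis
  proof cases
    case 2
    then have "q = pt r x y (d - Suc j)" using *(2,4) pt_swap[of "Suc j" r y x] by auto
    moreover have "d - Suc j = i - 1" using 2 by auto
    ultimately show ?thesis by simp
  qed (use * in auto)
qed

lemma neighbour_branch:
  assumes "((x, x, 0), q) \<in> E"
  shows "\<exists>y. (x, y) \<in> edges X \<and> q = pt r x y 1"
proof -
  obtain x' y' j where *: "(x', y') \<in> edges X" "j < d" "pt r x' y' j = (x, x, 0)" "q = pt r x' y' (Suc j)"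
    using assms by (auto simp: subdivision_def)
  then show ?thesis using pt_eq_branch[OF *(3) edge_distinct[OF *(1)]] by auto
qed

lemma irrefl_subdivision: "irrefl E"
proof (rule irreflI)
  fix p show "(p, p) \<notin> E"
  proof
    assume "(p, p) \<in> E"
    then obtain x y i where *: "(x, y) \<in> edges X" "i < d" "p = pt r x y i" "pt r x y i = pt r x y (Suc i)"
      by (auto simp: subdivision_def)
    show False
    proof (cases "i = 0")
      case True
      with * pt_eq_branch[of r x y "Suc i" x] edge_distinct[of x y] show False by auto
    next
      case False
      with * pt_eq_interior[of r x y i x y "Suc i"] edge_distinct[of x y] show False by auto
    qed
  qed
qed

lemma graph_subdivision: "graph (subdivision r X)"
  unfolding graph_def using sym_subdivision irrefl_subdivision
  by (auto simp: subdivision_def) (metis Suc_leI less_or_eq_imp_le)+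

lemma verts_subdivision_cases:
  assumes "p \<in> verts (subdivision r X)"
  obtains x where "x \<in> verts X" "p = (x, x, 0)"
    | x y i where "(x, y) \<in> edges X" "0 < i" "i < d" "p = pt r x y i"
proof -
  have "(\<exists>x\<in>verts X. p = (x, x, 0)) \<or> (\<exists>x y i. (x, y) \<in> edges X \<and> i \<le> d \<and> p = pt r x y i)"
    using assms by (auto simp: subdivision_def)
  moreover have "(\<exists>x\<in>verts X. p = (x, x, 0)) \<or> 0 < i \<and> i < d"
    if "(x, y) \<in> edges X" "i \<le> d" "p = pt r x y i" for x y i
    using that edge_verts[of x y] by (cases "i = 0"; cases "i = d") auto
  ultimately show thesis using that by blast
qed

text \<open>Serves both the cardinality bound and the proof that a homomorphism is determined by its
  values on branch vertices.\<close>

lemma verts_subdivision_subset: "verts (subdivision r X) \<subseteq> verts X \<times> verts X \<times> {..r}"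
proof
  fix p assume "p \<in> verts (subdivision r X)"
  then show "p \<in> verts X \<times> verts X \<times> {..r}"
  proof (cases rule: verts_subdivision_cases)
    case (2 x y i)
    then show ?thesis using edge_verts[of x y] by (auto simp: pt_def)
  qed auto
qed

text \<open>Inner vertices have only two neighbours, so a walk that never turns back has to follow
  the path it has entered up to its far end.\<close>

lemma path_from_branch:
  assumes w0: "w 0 = (a, a, 0)"
    and step: "\<And>i. i < d \<Longrightarrow> (w i, w (Suc i)) \<in> E"
    and nb: "\<And>i. Suc i < d \<Longrightarrow> w (Suc (Suc i)) \<noteq> w i"
  obtains b where "(a, b) \<in> edges X" "\<And>i. i \<le> d \<Longrightarrow> w i = pt r a b i"
proof -
  obtain b where b: "(a, b) \<in> edges X" "w 1 = pt r a b 1"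
    using neighbour_branch[of a "w 1"] step[of 0] w0 by auto
  have "Suc i \<le> d \<Longrightarrow> w i = pt r a b i \<and> w (Suc i) = pt r a b (Suc i)" for i
  proof (induction i)
    case (Suc i)
    then have "w (Suc (Suc i)) = pt r a b i \<or> w (Suc (Suc i)) = pt r a b (Suc (Suc i))"
      using neighbour_interior[OF b(1), of "Suc i"] step[of "Suc i"] by auto
    with Suc nb[of i] show ?case by auto
  qed (use w0 b in auto)
  moreover have "w 0 = pt r a b 0" using w0 by simp
  ultimately have "w i = pt r a b i" if "i \<le> d" for i
    using that by (cases i) auto
  with b show thesis using that by blast
qed

lemma reaches_branch:
  assumes step: "\<And>i. (w i, w (Suc i)) \<in> E" and nb: "\<And>i. w (Suc (Suc i)) \<noteq> w i"
  shows "\<exists>k a. w k = (a, a, 0)"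
proof -
  have "w 0 \<in> verts (subdivision r X)"
    using step[of 0] graph_subdivision by (auto simp: graph_def)
  then show ?thesis
  proof (cases rule: verts_subdivision_cases)
    case (2 x y i)
    have "w 1 = pt r x y (i - 1) \<or> w 1 = pt r x y (i + 1)"
      using neighbour_interior[OF 2(1-3), of "w 1"] step[of 0] 2(4) by simp
    \<comment> \<open>The edge is reoriented, if necessary, so that the first step raises the
      index.\<close>
    then obtain x' y' j where j: "(x', y') \<in> edges X" "0 < j" "j < d" "w 0 = pt r x' y' j" "w 1 = pt r x' y' (j + 1)"
    proof
      assume "w 1 = pt r x y (i - 1)"
      then show thesis
        using that[of y x "d - i"] 2 pt_swap[of i r x y] pt_swap[of "i - 1" r x y] edge_sym
        by (auto simp: Suc_diff_le)
    qed (use 2 that in auto)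
    have "j + Suc k \<le> d \<Longrightarrow> w k = pt r x' y' (j + k) \<and> w (Suc k) = pt r x' y' (j + Suc k)" for k
    proof (induction k)
      case (Suc k)
      then have "w (Suc (Suc k)) = pt r x' y' (j + k) \<or> w (Suc (Suc k)) = pt r x' y' (j + Suc (Suc k))"
        using neighbour_interior[OF j(1), of "j + Suc k" "w (Suc (Suc k))"] step[of "Suc k"] by auto
      with Suc nb[of k] show ?case by auto
    qed (use j in auto)
    from this[of "d - j - 1"] j have "w (Suc (d - j - 1)) = pt r x' y' d" by auto
    then show ?thesis by (metis Suc_eq_plus1 pt_end)
  qed auto
qed

text \<open>
  A closed walk without backtracking runs through whole subdivided edges; an odd one through an odd
  number of them, hence through at least three.
\<close>

lemma odd_closed_walk_length:
  assumes "(p, p) \<in> E ^^ l" and "odd l"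
  shows "3 * d \<le> l"
  using assms
proof (induction l arbitrary: p rule: less_induct)
  case (less l)
  then obtain f where f: "f 0 = p" "f l = p" "\<And>i. i < l \<Longrightarrow> (f i, f (Suc i)) \<in> E"
    unfolding relpow_fun_conv by auto
  have l0: "0 < l" using less.prems by (auto intro: Nat.gr0I)
  \<comment> \<open>Periodic extension, so that a backtrack at the closing point is treated like any
    other.\<close>
  define w where "w i = f (i mod l)" for i
  have step: "(w i, w (Suc i)) \<in> E" for i
    using f(3)[of "i mod l"] f(1,2) l0 by (auto simp: w_def mod_Suc)
  have per: "w (i + l) = w i" for i by (simp add: w_def)
  show ?case
  proof (cases "\<exists>t. w (Suc (Suc t)) = w t")
    \<comment> \<open>Cutting out a backtrack gives a closed walk shorter by two, hence still
      odd.\<close>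
    case True
    then obtain t where t: "w (Suc (Suc t)) = w t" ..
    have "l \<noteq> 1" using less.prems irreflD[OF irrefl_subdivision, of p] by auto
    then have l3: "3 \<le> l" using less.prems(2) l0 by (cases "l = 2") auto
    have "(w (t + 2), w (t + l)) \<in> E ^^ (t + l - (t + 2))"
      by (rule relpow_of_walk) (use step l3 in auto)
    then have "(w t, w t) \<in> E ^^ (l - 2)" using t per[of t] by (simp add: numeral_2_eq_2)
    then have "3 * d \<le> l - 2" using less.IH[of "l - 2"] less.prems(2) l3 by auto
    then show ?thesis by simp
  next
    case False
    then obtain k a where k: "w k = (a, a, 0)" using reaches_branch[of w] step by blast
    have run: "\<exists>b. (a, b) \<in> edges X \<and> (\<forall>i\<le>d. w (k + i) = pt r a b i)" if "w k = (a, a, 0)" for k a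
    proof -
      have "\<And>i. (w (k + i), w (k + Suc i)) \<in> E" "\<And>i. w (k + Suc (Suc i)) \<noteq> w (k + i)"
        using step False by auto
      then show ?thesis using path_from_branch[of "\<lambda>i. w (k + i)" a] that
        by (metis add.right_neutral)
    qed
    obtain b where b: "(a, b) \<in> edges X" "\<forall>i\<le>d. w (k + i) = pt r a b i" using run[OF k] by blast
    then have "w (k + d) = (b, b, 0)" using b(2)[rule_format, of d] by simp
    from run[OF this] obtain c where c: "(b, c) \<in> edges X" "\<forall>i\<le>d. w (k + d + i) = pt r b c i"
      by blast
    then have "w (k + d + d) = (c, c, 0)" using c(2)[rule_format, of d] by simp
    from run[OF this] obtain e where e: "(c, e) \<in> edges X" "\<forall>i\<le>d. w (k + d + d + i) = pt r c e i"
      by blast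
    have wl: "w (k + l) = (a, a, 0)" using k per by simp
    show ?thesis
    proof (rule ccontr)
      assume "\<not> ?thesis"
      \<comment> \<open>The walk meets branch vertices only at multiples of \<open>d\<close> from
        its start. Length \<open>d\<close> would need a loop in \<open>X\<close>, and
        \<open>2 * d\<close> is even.\<close>
      then consider "l \<le> d" | "d < l" "l < 2 * d" | "l = 2 * d" | "2 * d < l" "l < 3 * d" by linarith
      then show False
      proof cases
        case 1
        then show False
          using b wl l0 pt_eq_branch[of r a b l a] edge_distinct[OF b(1)] by auto
      next
        case 2
        then have "pt r b c (l - d) = (a, a, 0)" "0 < l - d" "l - d < d"
          using c(2)[rule_format, of "l - d"] wl by auto
        then show False
          using pt_eq_branch[of r b c "l - d" a] edge_distinct[OF c(1)] by auto
      next
        case 3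
        then show False using less.prems(2) by simp
      next
        case 4
        then obtain m where m: "l = 2 * d + m" "0 < m" "m < d"
          using less_imp_add_positive[of "2 * d" l] by auto
        then have "pt r c e m = (a, a, 0)"
          using e(2)[rule_format, of m] wl by (simp add: algebra_simps)
        then show False
          using m pt_eq_branch[of r c e m a] edge_distinct[OF e(1)] by auto
      qed
    qed
  qed
qed

end

lemma pt_walk:
  assumes "(x, y) \<in> edges X" "i \<le> j" "j \<le> 2 * r + 1"
  shows "(pt r x y i, pt r x y j) \<in> edges (subdivision r X) ^^ (j - i)"
  using assms by (intro relpow_of_walk) (auto simp: edges_subdivisionI)

context
  fixes r :: nat and X :: "'a graph" and Y :: "'b graph" and F
  assumes graph_X: "graph X" and graph_Y: "graph Y"
    and F: "F \<in> graph_homs (subdivision r X) (subdivision r Y)"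
begin

private abbreviation "d' \<equiv> 2 * r + 1"

text \<open>If the image turned back, the rest of the subdivided triangle, from index
  \<open>i + 2\<close> via \<open>y\<close>, \<open>z\<close> and \<open>x\<close> to index
  \<open>i\<close>, would have a closed image of odd length \<open>3 * d' - 2\<close>.\<close>

lemma hom_no_backtrack:
  assumes xy: "(x, y) \<in> edges X" and yz: "(y, z) \<in> edges X" and zx: "(z, x) \<in> edges X"
    and i: "Suc i < d'"
  shows "F (pt r x y (Suc (Suc i))) \<noteq> F (pt r x y i)"
proof
  let ?E = "edges (subdivision r X)"
  assume eq: "F (pt r x y (Suc (Suc i))) = F (pt r x y i)"
  have "(pt r x y (Suc (Suc i)), (y, y, 0)) \<in> ?E ^^ (d' - Suc (Suc i))"
    using pt_walk[OF xy, of "Suc (Suc i)" d' r] i by simp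
  moreover have "((y, y, 0), (z, z, 0)) \<in> ?E ^^ d'" "((z, z, 0), (x, x, 0)) \<in> ?E ^^ d'"
    using pt_walk[OF yz, of 0 d' r] pt_walk[OF zx, of 0 d' r] by auto
  moreover have "((x, x, 0), pt r x y i) \<in> ?E ^^ i"
    using pt_walk[OF xy, of 0 i r] i by simp
  ultimately have "(pt r x y (Suc (Suc i)), pt r x y i) \<in> ?E ^^ (d' - Suc (Suc i) + d' + d' + i)"
    unfolding relpow_add by blast
  then have "(F (pt r x y i), F (pt r x y i)) \<in> edges (subdivision r Y) ^^ (d' - Suc (Suc i) + d' + d' + i)"
    using relpow_hom[where f = F] graph_homs_edge[OF F] eq by metis
  moreover have "odd (d' - Suc (Suc i) + d' + d' + i)" "d' - Suc (Suc i) + d' + d' + i < 3 * d'"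
    using i by auto
  ultimately show False using odd_closed_walk_length[OF graph_Y] by fastforce
qed

text \<open>Going around the triangle while avoiding \<open>x\<close> joins the two vertices by a
  walk of length \<open>6 * r + 1 = 3 * d' - 2\<close>; equal images would close it.\<close>

lemma hom_branch_split:
  assumes xy: "(x, y) \<in> edges X" and yz: "(y, z) \<in> edges X" and zx: "(z, x) \<in> edges X"
    and r: "1 \<le> r"
  shows "F (pt r x y 1) \<noteq> F (pt r x z 1)"
proof
  let ?E = "edges (subdivision r X)"
  assume eq: "F (pt r x y 1) = F (pt r x z 1)"
  have "(pt r x y 1, (y, y, 0)) \<in> ?E ^^ (2 * r)" "((y, y, 0), (z, z, 0)) \<in> ?E ^^ d'"
    "((z, z, 0), pt r z x (2 * r)) \<in> ?E ^^ (2 * r)"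
    using pt_walk[OF xy, of 1 d' r] pt_walk[OF yz, of 0 d' r] pt_walk[OF zx, of 0 "2 * r" r] by auto
  then have "(pt r x y 1, pt r z x (2 * r)) \<in> ?E ^^ (2 * r + d' + 2 * r)"
    unfolding relpow_add by blast
  moreover have "pt r z x (2 * r) = pt r x z 1" using pt_swap[of 1 r x z] r by simp
  ultimately have "(F (pt r x y 1), F (pt r x y 1)) \<in> edges (subdivision r Y) ^^ (2 * r + d' + 2 * r)"
    using relpow_hom[where f = F] graph_homs_edge[OF F] eq by metis
  then show False using odd_closed_walk_length[OF graph_Y] by fastforce
qed

text \<open>
  The three directions in which a branch vertex can be left inside a \<open>K\<^sub>4\<close> have different images,
  so its image is not an inner vertex of a subdivided edge.
\<close>

lemma subdivision_hom:
  assumes K4: "K4_covered X" and r: "1 \<le> r"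
  obtains f where "f \<in> graph_homs X Y"
    "\<And>x y i. (x, y, i) \<in> verts (subdivision r X) \<Longrightarrow> F (x, y, i) = (f x, f y, i)"
proof -
  have FV: "F p \<in> verts (subdivision r Y)" if "p \<in> verts (subdivision r X)" for p
    using F that by (auto simp: graph_homs_def)
  have branch: "\<exists>y\<in>verts Y. F (x, x, 0) = (y, y, 0)" if x: "x \<in> verts X" for x
  proof -
    obtain x1 x2 x3 where *: "(x, x1) \<in> edges X" "(x, x2) \<in> edges X" "(x, x3) \<in> edges X"
      "(x1, x2) \<in> edges X" "(x1, x3) \<in> edges X" "(x2, x3) \<in> edges X"
    proof -
      obtain x1 where x1: "(x, x1) \<in> edges X" using K4 x by (auto simp: K4_covered_def)
      from K4_coveredE[OF K4 x1] obtain z w where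
        "{(x, z), (x, w), (x1, z), (x1, w), (z, w)} \<subseteq> edges X" .
      then show thesis using x1 by (intro that[of x1 z w]) auto
    qed
    note s = edge_sym[OF graph_X]
    have ne: "F (pt r x x1 1) \<noteq> F (pt r x x2 1)" "F (pt r x x1 1) \<noteq> F (pt r x x3 1)"
      "F (pt r x x2 1) \<noteq> F (pt r x x3 1)"
      using hom_branch_split[OF *(1,4) s[OF *(2)] r] hom_branch_split[OF *(1,5) s[OF *(3)] r]
        hom_branch_split[OF *(2,6) s[OF *(3)] r] by auto
    have "F (x, x, 0) \<in> verts (subdivision r Y)" using x by (intro FV) (auto simp: subdivision_def)
    then show ?thesis
    proof (cases rule: verts_subdivision_cases[OF graph_Y, consumes 1])
      case (2 a b i)
      have "F (pt r x x' 1) = pt r a b (i - 1) \<or> F (pt r x x' 1) = pt r a b (i + 1)"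
        if "(x, x') \<in> edges X" for x'
        using graph_homs_edge[OF F edges_subdivisionI[OF that, of 0]] 2
        by (intro neighbour_interior[OF graph_Y]) auto
      with ne * show ?thesis by metis
    qed auto
  qed
  then obtain f where f: "\<And>x. x \<in> verts X \<Longrightarrow> f x \<in> verts Y \<and> F (x, x, 0) = (f x, f x, 0)"
    by metis
  \<comment> \<open>The image of a subdivided edge starts at a branch vertex and never turns back,
    so it is a whole subdivided edge; its last point identifies the far end as
    \<open>f y\<close>.\<close>
  have edge: "(f x, f y) \<in> edges Y \<and> (\<forall>i\<le>d'. F (pt r x y i) = pt r (f x) (f y) i)"
    if xy: "(x, y) \<in> edges X" for x y
  proof -
    from K4_coveredE[OF K4 xy] obtain z w where
      "{(x, z), (x, w), (y, z), (y, w), (z, w)} \<subseteq> edges X" .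
    then have z: "(y, z) \<in> edges X" "(z, x) \<in> edges X" using edge_sym[OF graph_X] by auto
    have fx: "F (pt r x y 0) = (f x, f x, 0)" "F (pt r x y d') = (f y, f y, 0)"
      using f edge_verts[OF graph_X xy] by auto
    from path_from_branch[OF graph_Y, of "\<lambda>i. F (pt r x y i)" "f x" r,
        OF fx(1) graph_homs_edge[OF F edges_subdivisionI[OF xy]] hom_no_backtrack[OF xy z]]
    obtain b where b: "(f x, b) \<in> edges Y" "\<And>i. i \<le> d' \<Longrightarrow> F (pt r x y i) = pt r (f x) b i"
      by auto
    moreover have "b = f y" using b(2)[of d'] fx by simp
    ultimately show ?thesis by simp
  qed
  let ?f = "restrict f (verts X)"
  have "?f \<in> graph_homs X Y"
    using f edge edge_verts[OF graph_X] by (auto simp: graph_homs_def)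
  moreover have "F (x, y, i) = (?f x, ?f y, i)" if v: "(x, y, i) \<in> verts (subdivision r X)" for x y i
    using v
  proof (cases rule: verts_subdivision_cases[OF graph_X, consumes 1])
    case (2 x' y' j)
    have "F (x, y, i) = pt r (f x') (f y') j" using edge[OF 2(1)] 2(3) unfolding 2(4) by simp
    moreover have "x' \<in> verts X" "y' \<in> verts X" using edge_verts[OF graph_X 2(1)] by auto
    ultimately show ?thesis
      using 2(2-4) by (cases "j \<le> r") (simp_all add: pt_def)
  next
    case (1 a)
    then show ?thesis using f[of a] by simp
  qed
  ultimately show thesis using that by blast
qed

end

lemma subdivision_lift:
  assumes f: "f \<in> graph_homs X Y" and graph_X: "graph X"
  shows "(\<lambda>(x, y, i)\<in>verts (subdivision r X). (f x, f y, i)) \<in> graph_homs (subdivision r X) (subdivision r Y)"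
    (is "?F \<in> _")
proof -
  have pt: "(case pt r x y i of (x, y, i) \<Rightarrow> (f x, f y, i)) = pt r (f x) (f y) i" for x y i
    by (auto simp: pt_def)
  have "(case p of (x, y, i) \<Rightarrow> (f x, f y, i)) \<in> verts (subdivision r Y)"
    if "p \<in> verts (subdivision r X)" for p
    using that
  proof (cases rule: verts_subdivision_cases[OF graph_X, consumes 1])
    case (2 x y i)
    then show ?thesis
      unfolding 2 pt using graph_homs_edge[OF f 2(1)] 2(3) by (intro pt_in_verts) auto
  qed (use f in \<open>auto simp: subdivision_def graph_homs_def\<close>)
  moreover have "(?F p, ?F q) \<in> edges (subdivision r Y)" if pq: "(p, q) \<in> edges (subdivision r X)" for p q
  proof -
    obtain x y i where *: "(x, y) \<in> edges X" "i < 2 * r + 1" "p = pt r x y i" "q = pt r x y (Suc i)"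
      using pq by (auto simp: subdivision_def)
    have "p \<in> verts (subdivision r X)" "q \<in> verts (subdivision r X)"
      using pq graph_subdivision[OF graph_X, of r] by (auto simp: graph_def)
    then show ?thesis
      using edges_subdivisionI[of "f x" "f y" Y i r] *(2) graph_homs_edge[OF f *(1)]
      unfolding *(3,4) by (simp add: pt)
  qed
  ultimately show ?thesis by (auto simp: graph_homs_def)
qed

section \<open>Gluing copies of a rigid graph along tuples\<close>

text \<open>
  A tuple is a partial map from positions to elements; its domain tells which relation it belongs to.
\<close>

type_synonym 'v tuple = "nat \<Rightarrow> 'v option"

record 'v tuple_system =
  elems :: "'v set"
  tuples :: "'v tuple set"

definition system_homs :: "'v tuple_system \<Rightarrow> 'w tuple_system \<Rightarrow> ('v \<Rightarrow> 'w) set" where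
  "system_homs D D' =
     {f \<in> elems D \<rightarrow>\<^sub>E elems D'. \<forall>\<tau>\<in>tuples D. map_option f \<circ> \<tau> \<in> tuples D'}"

text \<open>
  The last condition makes elements recognizable after gluing: only they can occupy two different
  positions in copies of a rigid graph.
\<close>

definition gluable :: "nat set \<Rightarrow> nat set set \<Rightarrow> 'v tuple_system \<Rightarrow> bool" where
  "gluable T \<D> D \<longleftrightarrow>
     (\<forall>\<tau>\<in>tuples D. dom \<tau> \<subseteq> T \<and> dom \<tau> \<in> \<D> \<and> ran \<tau> \<subseteq> elems D \<and> inj_on \<tau> (dom \<tau>)) \<and>
     (\<forall>v\<in>elems D. \<exists>\<tau>\<in>tuples D. \<exists>\<tau>'\<in>tuples D. \<exists>p q. p \<noteq> q \<and> \<tau> p = Some v \<and> \<tau>' q = Some v)"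

text \<open>Positions filled by a tuple are glued to the elements they hold; all other vertices of a
  copy are private and carry the tuple as their name.\<close>

datatype 'v gvertex = Elem 'v | Inner "'v tuple" nat

definition loc :: "'v tuple \<Rightarrow> nat \<Rightarrow> 'v gvertex" where
  "loc \<tau> p = (case \<tau> p of Some v \<Rightarrow> Elem v | None \<Rightarrow> Inner \<tau> p)"

definition glue :: "nat \<Rightarrow> (nat \<times> nat) set \<Rightarrow> 'v tuple_system \<Rightarrow> 'v gvertex graph" where
  "glue N E D =
     \<lparr>verts = Elem ` elems D \<union> {loc \<tau> p | \<tau> p. \<tau> \<in> tuples D \<and> p < N},
      edges = {(loc \<tau> p, loc \<tau> q) | \<tau> p q. \<tau> \<in> tuples D \<and> (p, q) \<in> E}\<rparr>"

text \<open>Filled positions could collide only if the tuple repeated an element, and private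
  vertices remember their position. So each copy of the gadget is embedded without
  identifications.\<close>

lemma loc_inj:
  assumes "inj_on \<tau> (dom \<tau>)" "loc \<tau> p = loc \<tau> q"
  shows "p = q"
proof (cases "\<tau> p")
  case (Some v)
  then have "\<tau> q = Some v" using assms(2) by (cases "\<tau> q") (auto simp: loc_def)
  then show ?thesis using Some inj_onD[OF assms(1), of p q] by auto
qed (use assms(2) in \<open>auto simp: loc_def split: option.splits\<close>)

lemma loc_None [simp]: "\<tau> p = None \<Longrightarrow> loc \<tau> p = Inner \<tau> p"
  by (simp add: loc_def)

lemma loc_Some [simp]: "\<tau> p = Some v \<Longrightarrow> loc \<tau> p = Elem v"
  by (simp add: loc_def)

lemma loc_eq_Inner: "loc \<tau> p = Inner \<sigma> q \<longleftrightarrow> \<tau> p = None \<and> \<tau> = \<sigma> \<and> p = q"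
  by (auto simp: loc_def split: option.splits)

lemma loc_eq_Elem: "loc \<tau> p = Elem v \<longleftrightarrow> \<tau> p = Some v"
  by (auto simp: loc_def split: option.splits)

text \<open>
  By \<open>stacked\<close> any two vertices are linked by triangles with common edges. Each triangle of a glued
  graph lies in one copy, so the image of a copy does, too.
\<close>

locale gadget =
  fixes N :: nat and E :: "(nat \<times> nat) set" and T :: "nat set" and \<D> :: "nat set set"
  assumes E_less: "(p, q) \<in> E \<Longrightarrow> p < N \<and> q < N"
    and E_sym: "sym E" and E_irrefl: "irrefl E"
    and T_less: "p \<in> T \<Longrightarrow> p < N"
    and T_independent: "(p, q) \<in> E \<Longrightarrow> p \<notin> T \<or> q \<notin> T"
    and start: "(0, 1) \<in> E"
    and stacked: "2 \<le> k \<Longrightarrow> k < N \<Longrightarrow> \<exists>i<k. \<exists>j<k. {(i, j), (i, k), (j, k)} \<subseteq> E"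
    and E_K4: "(p, q) \<in> E \<Longrightarrow> \<exists>r s. {(p, r), (p, s), (q, r), (q, s), (r, s)} \<subseteq> E"
    and rigid: "(\<And>p. p < N \<Longrightarrow> g p < N) \<Longrightarrow> (\<And>p q. (p, q) \<in> E \<Longrightarrow> (g p, g q) \<in> E) \<Longrightarrow> p < N \<Longrightarrow> g p = p"
    and \<D>_antichain: "A \<in> \<D> \<Longrightarrow> B \<in> \<D> \<Longrightarrow> A \<subseteq> B \<Longrightarrow> A = B"
begin

lemma position_has_edge:
  assumes "p < N" shows "\<exists>q. (p, q) \<in> E"
proof (cases "2 \<le> p")
  case True
  then show ?thesis using stacked[of p] assms symD[OF E_sym] by blast
next
  case False
  then consider "p = 0" | "p = 1" by linarith
  then show ?thesis using start symD[OF E_sym start] by cases auto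
qed

context
  fixes D :: "'v tuple_system"
  assumes D: "gluable T \<D> D"
begin

lemma tuple_inj: "\<tau> \<in> tuples D \<Longrightarrow> inj_on \<tau> (dom \<tau>)"
  using D by (auto simp: gluable_def)

lemma tuple_elem: "\<tau> \<in> tuples D \<Longrightarrow> \<tau> p = Some v \<Longrightarrow> v \<in> elems D \<and> p \<in> T"
  using D by (force simp: gluable_def ran_def)

lemma glue_edge_cases:
  assumes "(x, y) \<in> edges (glue N E D)"
  obtains \<tau> p q where "\<tau> \<in> tuples D" "(p, q) \<in> E" "x = loc \<tau> p" "y = loc \<tau> q"
  using assms by (auto simp: glue_def)

lemma glue_edgeI: "\<tau> \<in> tuples D \<Longrightarrow> (p, q) \<in> E \<Longrightarrow> (loc \<tau> p, loc \<tau> q) \<in> edges (glue N E D)"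
  by (auto simp: glue_def)

lemma sym_glue: "sym (edges (glue N E D))"
proof (rule symI)
  fix x y assume "(x, y) \<in> edges (glue N E D)"
  then obtain \<tau> p q where "\<tau> \<in> tuples D" "(p, q) \<in> E" "x = loc \<tau> p" "y = loc \<tau> q"
    by (rule glue_edge_cases)
  then show "(y, x) \<in> edges (glue N E D)" using symD[OF E_sym] glue_edgeI by blast
qed

lemma graph_glue: "graph (glue N E D)"
proof -
  have "edges (glue N E D) \<subseteq> verts (glue N E D) \<times> verts (glue N E D)"
    using E_less by (auto simp: glue_def)
  moreover have "irrefl (edges (glue N E D))"
  proof (rule irreflI, rule notI)
    fix x assume "(x, x) \<in> edges (glue N E D)"
    then obtain \<tau> p q where "\<tau> \<in> tuples D" "(p, q) \<in> E" "loc \<tau> p = loc \<tau> q"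
      by (auto simp: glue_def)
    then show False using loc_inj[OF tuple_inj] irreflD[OF E_irrefl] by metis
  qed
  ultimately show ?thesis using sym_glue by (simp add: graph_def)
qed

lemma edge_Inner:
  assumes "(Inner \<tau> p, y) \<in> edges (glue N E D)"
  shows "\<tau> \<in> tuples D \<and> \<tau> p = None \<and> (\<exists>q. (p, q) \<in> E \<and> y = loc \<tau> q)"
proof -
  obtain \<sigma> p' q where *: "\<sigma> \<in> tuples D" "(p', q) \<in> E" "loc \<sigma> p' = Inner \<tau> p" "y = loc \<sigma> q"
    using assms by (auto simp: glue_def)
  then show ?thesis by (auto simp: loc_eq_Inner)
qed

text \<open>Elements occupy only positions in the independent set \<open>T\<close>. Hence every edge
  has a private end, and this end names its copy.\<close>

lemma no_Elem_edge: "(Elem v, Elem w) \<notin> edges (glue N E D)"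
proof
  assume "(Elem v, Elem w) \<in> edges (glue N E D)"
  then obtain \<tau> p q where *: "\<tau> \<in> tuples D" "(p, q) \<in> E" "loc \<tau> p = Elem v" "loc \<tau> q = Elem w"
    by (auto simp: glue_def)
  then show False using tuple_elem[OF *(1)] T_independent[OF *(2)] by (auto simp: loc_eq_Elem)
qed

definition in_copy :: "'v tuple \<Rightarrow> 'v gvertex \<Rightarrow> bool" where
  "in_copy \<tau> x \<longleftrightarrow> \<tau> \<in> tuples D \<and> (\<exists>p<N. x = loc \<tau> p)"

lemma edge_in_copy: "(x, y) \<in> edges (glue N E D) \<Longrightarrow> \<exists>\<tau>. in_copy \<tau> x \<and> in_copy \<tau> y"
  using E_less by (auto simp: glue_def in_copy_def)

lemma Inner_in_copy: "in_copy \<tau> (Inner \<sigma> p) \<Longrightarrow> \<tau> = \<sigma>"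
  by (auto simp: in_copy_def) (metis loc_eq_Inner)

text \<open>One of \<open>x\<close> and \<open>y\<close> is private, and all edges at a private
  vertex stay in its copy.\<close>

lemma triangle_in_copy:
  assumes xy: "(x, y) \<in> edges (glue N E D)" and xz: "(x, z) \<in> edges (glue N E D)"
    and yz: "(y, z) \<in> edges (glue N E D)" and c: "in_copy \<tau> x" "in_copy \<tau> y"
  shows "in_copy \<tau> z"
proof -
  have "\<exists>\<sigma> p. x = Inner \<sigma> p \<or> y = Inner \<sigma> p"
    using no_Elem_edge xy by (metis gvertex.exhaust)
  then obtain \<sigma> p u where u: "u = Inner \<sigma> p" "in_copy \<tau> u" "(u, z) \<in> edges (glue N E D)"
    using xz yz c by blast
  have "\<sigma> = \<tau>" using u Inner_in_copy by blast
  then obtain q where "(p, q) \<in> E" "z = loc \<tau> q" "\<tau> \<in> tuples D" using edge_Inner u by blast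
  then show ?thesis using E_less by (auto simp: in_copy_def)
qed

text \<open>A private end shows that the edge was created by the copy \<open>\<tau>\<close> itself,
  and \<open>loc_inj\<close> recovers the positions: copies are induced subgraphs.\<close>

lemma copy_edge:
  assumes "(loc \<tau> p, loc \<tau> q) \<in> edges (glue N E D)" "\<tau> \<in> tuples D"
  shows "(p, q) \<in> E"
proof -
  note inj = loc_inj[OF tuple_inj[OF assms(2)]]
  show ?thesis
  proof (cases "\<tau> p")
    case None
    then obtain q' where "(p, q') \<in> E" "loc \<tau> q = loc \<tau> q'"
      using edge_Inner[of \<tau> p "loc \<tau> q"] assms(1) by auto
    then show ?thesis using inj by blast
  next
    case (Some v)
    then have "\<tau> q = None" using no_Elem_edge assms(1) by (cases "\<tau> q") auto
    then obtain p' where "(q, p') \<in> E" "loc \<tau> p = loc \<tau> p'"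
      using edge_Inner[of \<tau> q "loc \<tau> p"] symD[OF sym_glue assms(1)] by auto
    then have "(q, p) \<in> E" using inj by blast
    then show ?thesis by (rule symD[OF E_sym])
  qed
qed

lemma K4_covered_glue: "K4_covered (glue N E D)"
proof -
  have "verts (glue N E D) \<subseteq> Domain (edges (glue N E D))"
  proof
    fix x assume x: "x \<in> verts (glue N E D)"
    then obtain \<tau> p where "\<tau> \<in> tuples D" "p < N" "x = loc \<tau> p"
    proof -
      assume *: "\<And>\<tau> p. \<tau> \<in> tuples D \<Longrightarrow> p < N \<Longrightarrow> x = loc \<tau> p \<Longrightarrow> thesis"
      consider v where "v \<in> elems D" "x = Elem v" | \<tau> p where "\<tau> \<in> tuples D" "p < N" "x = loc \<tau> p"
        using x by (auto simp: glue_def)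
      then show thesis
      proof cases
        case (1 v)
        then obtain \<tau> p where "\<tau> \<in> tuples D" "\<tau> p = Some v" using D by (auto simp: gluable_def)
        then show thesis using * 1 tuple_elem T_less by fastforce
      qed (use * in auto)
    qed
    then show "x \<in> Domain (edges (glue N E D))"
      using position_has_edge[of p] glue_edgeI by blast
  qed
  moreover have "\<exists>z w. {(x, z), (x, w), (y, z), (y, w), (z, w)} \<subseteq> edges (glue N E D)"
    if "(x, y) \<in> edges (glue N E D)" for x y
  proof -
    obtain \<tau> p q where *: "\<tau> \<in> tuples D" "(p, q) \<in> E" "x = loc \<tau> p" "y = loc \<tau> q"
      using \<open>(x, y) \<in> edges (glue N E D)\<close> by (rule glue_edge_cases)
    obtain r s where "{(p, r), (p, s), (q, r), (q, s), (r, s)} \<subseteq> E" using E_K4[OF *(2)] by blast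
    then show ?thesis using * glue_edgeI
      by (intro exI[of _ "loc \<tau> r"] exI[of _ "loc \<tau> s"]) auto
  qed
  ultimately show ?thesis by (auto simp: K4_covered_def)
qed

end

text \<open>A copy lands in a single copy. As copies are induced subgraphs, this gives an
  endomorphism of the gadget, which is the identity by rigidity; so positions are preserved and
  tuples go to tuples.\<close>

lemma glue_hom:
  assumes D: "gluable T \<D> D" and D': "gluable T \<D> D'"
    and F: "F \<in> graph_homs (glue N E D) (glue N E D')"
  obtains f where "f \<in> system_homs D D'" "\<And>v. v \<in> elems D \<Longrightarrow> F (Elem v) = Elem (f v)"
    "\<And>\<tau> p. \<tau> \<in> tuples D \<Longrightarrow> p < N \<Longrightarrow> F (loc \<tau> p) = loc (map_option f \<circ> \<tau>) p"
proof -
  let ?E' = "edges (glue N E D')"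
  have copy: "\<exists>\<sigma>\<in>tuples D'. \<forall>p<N. F (loc \<tau> p) = loc \<sigma> p" if \<tau>: "\<tau> \<in> tuples D" for \<tau>
  proof -
    define G where "G p = F (loc \<tau> p)" for p
    have edge: "(G p, G q) \<in> ?E'" if "(p, q) \<in> E" for p q
      unfolding G_def using graph_homs_edge[OF F glue_edgeI[OF D \<tau> that]] .
    obtain \<sigma> where \<sigma>: "in_copy D' \<sigma> (G 0)" "in_copy D' \<sigma> (G 1)"
      using edge_in_copy[OF D' edge[OF start]] by blast
    have "in_copy D' \<sigma> (G k)" if "k < N" for k
      using that
    proof (induction k rule: less_induct)
      case (less k)
      show ?case
      proof (cases "2 \<le> k")
        case True
        then obtain i j where ij: "i < k" "j < k" "(i, j) \<in> E" "(i, k) \<in> E" "(j, k) \<in> E"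
          using stacked[OF True less.prems] by auto
        then show ?thesis
          using triangle_in_copy[OF D' edge[OF ij(3)] edge[OF ij(4)] edge[OF ij(5)]] less by auto
      next
        case False
        then have "k = 0 \<or> k = 1" by linarith
        then show ?thesis using \<sigma> by auto
      qed
    qed
    then obtain g where g: "\<And>p. p < N \<Longrightarrow> g p < N \<and> G p = loc \<sigma> (g p)"
      unfolding in_copy_def[OF D'] by metis
    have \<sigma>': "\<sigma> \<in> tuples D'" using \<sigma> by (simp add: in_copy_def[OF D'])
    have "(g p, g q) \<in> E" if "(p, q) \<in> E" for p q
      using copy_edge[OF D' _ \<sigma>'] edge[OF that] g E_less[OF that] by metis
    then have "\<And>p. p < N \<Longrightarrow> g p = p" using rigid[of g] g by blast
    then show ?thesis using g \<sigma>' unfolding G_def by metis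
  qed
  \<comment> \<open>The image of \<open>v\<close> sits at position \<open>p\<close> of one copy and
    at position \<open>q\<close> of another; a private vertex has only one position.\<close>
  have "\<exists>w\<in>elems D'. F (Elem v) = Elem w" if "v \<in> elems D" for v
  proof -
    obtain \<tau> \<tau>' p q where *: "\<tau> \<in> tuples D" "\<tau>' \<in> tuples D" "p \<noteq> q" "\<tau> p = Some v" "\<tau>' q = Some v"
      using D \<open>v \<in> elems D\<close> unfolding gluable_def by metis
    have "p < N" "q < N" using tuple_elem[OF D] * T_less by blast+
    then obtain \<sigma> \<sigma>' where **: "\<sigma> \<in> tuples D'" "F (Elem v) = loc \<sigma> p" "F (Elem v) = loc \<sigma>' q"
      using copy[OF *(1)] copy[OF *(2)] * loc_Some by metis
    show ?thesis
    proof (cases "\<sigma> p")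
      case None
      then have "loc \<sigma>' q = Inner \<sigma> p" using ** by simp
      then show ?thesis using *(3) by (simp add: loc_eq_Inner)
    next
      case (Some w)
      then show ?thesis using tuple_elem[OF D' **(1) Some] ** by auto
    qed
  qed
  then obtain f0 where f0: "\<And>v. v \<in> elems D \<Longrightarrow> f0 v \<in> elems D' \<and> F (Elem v) = Elem (f0 v)" by metis
  define f where "f = restrict f0 (elems D)"
  have f: "v \<in> elems D \<Longrightarrow> f v \<in> elems D' \<and> F (Elem v) = Elem (f v)" for v
    using f0 by (simp add: f_def)
  have tup: "map_option f \<circ> \<tau> \<in> tuples D' \<and> (\<forall>p<N. F (loc \<tau> p) = loc (map_option f \<circ> \<tau>) p)"
    if \<tau>: "\<tau> \<in> tuples D" for \<tau>
  proof -
    obtain \<sigma> where \<sigma>: "\<sigma> \<in> tuples D'" "\<And>p. p < N \<Longrightarrow> F (loc \<tau> p) = loc \<sigma> p"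
      using copy[OF \<tau>] by blast
    have some: "\<sigma> p = Some (f v)" if "\<tau> p = Some v" for p v
    proof -
      have "v \<in> elems D" "p < N" using tuple_elem[OF D \<tau> that] T_less by auto
      then have "loc \<sigma> p = Elem (f v)" using \<sigma>(2)[of p] f that by simp
      then show ?thesis by (simp add: loc_eq_Elem)
    qed
    \<comment> \<open>So far \<open>\<sigma>\<close> could be filled at further positions; the
      antichain condition rules this out.\<close>
    then have "dom \<tau> \<subseteq> dom \<sigma>" by auto
    then have "dom \<tau> = dom \<sigma>" using \<D>_antichain D D' \<tau> \<sigma>(1) by (auto simp: gluable_def)
    then have "\<sigma> p = map_option f (\<tau> p)" for p
      using some by (cases "\<tau> p") auto
    then have "\<sigma> = map_option f \<circ> \<tau>" by auto
    then show ?thesis using \<sigma> by auto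
  qed
  have "f \<in> system_homs D D'"
    using tup f by (auto simp: system_homs_def f_def)
  then show thesis using that tup f by blast
qed

lemma glue_lift:
  assumes D: "gluable T \<D> D" and f: "f \<in> system_homs D D'"
  shows "(\<lambda>x\<in>verts (glue N E D). case x of Elem v \<Rightarrow> Elem (f v) | Inner \<tau> p \<Rightarrow> Inner (map_option f \<circ> \<tau>) p)
    \<in> graph_homs (glue N E D) (glue N E D')" (is "restrict ?F _ \<in> _")
proof -
  have loc: "?F (loc \<tau> p) = loc (map_option f \<circ> \<tau>) p" for \<tau> p
    by (cases "\<tau> p") auto
  have "?F x \<in> verts (glue N E D')" if x: "x \<in> verts (glue N E D)" for x
  proof -
    consider v where "v \<in> elems D" "x = Elem v" | \<tau> p where "\<tau> \<in> tuples D" "p < N" "x = loc \<tau> p"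
      using x by (auto simp: glue_def)
    then show ?thesis
    proof cases
      case 1
      then show ?thesis using f by (auto simp: glue_def system_homs_def)
    next
      case 2
      then show ?thesis unfolding 2(3) loc using f by (auto simp: glue_def system_homs_def)
    qed
  qed
  moreover have "(?F x, ?F y) \<in> edges (glue N E D') \<and> x \<in> verts (glue N E D) \<and> y \<in> verts (glue N E D)"
    if xy: "(x, y) \<in> edges (glue N E D)" for x y
  proof -
    obtain \<tau> p q where *: "\<tau> \<in> tuples D" "(p, q) \<in> E" "x = loc \<tau> p" "y = loc \<tau> q"
      using xy by (auto simp: glue_def)
    moreover have "(loc (map_option f \<circ> \<tau>) p, loc (map_option f \<circ> \<tau>) q) \<in> edges (glue N E D')"
    proof -
      have "map_option f \<circ> \<tau> \<in> tuples D'" using * f by (auto simp: system_homs_def)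
      then show ?thesis using *(2) unfolding glue_def graph.select_convs by blast
    qed
    ultimately show ?thesis
      unfolding *(3,4) loc using E_less[OF *(2)] by (auto simp: glue_def)
  qed
  ultimately show ?thesis by (auto simp: graph_homs_def)
qed

end

section \<open>A rigid structure on a well-ordered set\<close>

text \<open>The greatest element is there so that every increasing sequence has a least upper bound
  in \<open>W\<close>.\<close>

locale well_ordered_set =
  fixes W :: "'w set" and less :: "'w \<Rightarrow> 'w \<Rightarrow> bool" (infix "\<sqsubset>" 50) and bot top :: 'w
  assumes irrefl: "x \<in> W \<Longrightarrow> \<not> x \<sqsubset> x"
    and trans: "x \<in> W \<Longrightarrow> y \<in> W \<Longrightarrow> z \<in> W \<Longrightarrow> x \<sqsubset> y \<Longrightarrow> y \<sqsubset> z \<Longrightarrow> x \<sqsubset> z"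
    and linear: "x \<in> W \<Longrightarrow> y \<in> W \<Longrightarrow> x \<noteq> y \<Longrightarrow> x \<sqsubset> y \<or> y \<sqsubset> x"
    and least: "S \<subseteq> W \<Longrightarrow> S \<noteq> {} \<Longrightarrow> \<exists>x\<in>S. \<forall>y\<in>S. \<not> y \<sqsubset> x"
    and bot: "bot \<in> W" "x \<in> W \<Longrightarrow> \<not> x \<sqsubset> bot"
    and top: "top \<in> W" "x \<in> W \<Longrightarrow> \<not> top \<sqsubset> x"
begin

text \<open>Such an \<open>e\<close> is a limit of cofinality omega. Starting all ladders at
  \<open>bot\<close>, which is preserved, anchors the comparison of a ladder with its image.\<close>

definition ladder_for :: "'w \<Rightarrow> (nat \<Rightarrow> 'w) \<Rightarrow> bool" where
  "ladder_for e s \<longleftrightarrow> s 0 = bot \<and> (\<forall>n. s n \<in> W \<and> s n \<sqsubset> s (Suc n) \<and> s n \<sqsubset> e) \<and>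
     (\<forall>y\<in>W. y \<sqsubset> e \<longrightarrow> (\<exists>n. y \<sqsubset> s n))"

definition limits :: "'w set" where
  "limits = {e \<in> W. \<exists>s. ladder_for e s}"

definition ladder :: "'w \<Rightarrow> nat \<Rightarrow> 'w" where
  "ladder e = (SOME s. ladder_for e s)"

lemma ladder: "e \<in> limits \<Longrightarrow> ladder_for e (ladder e)"
  unfolding limits_def ladder_def by (auto intro: someI[of "ladder_for e"])

lemma increasing:
  assumes "\<And>n. s n \<in> W" "\<And>n. s n \<sqsubset> s (Suc n)" "m < n"
  shows "s m \<sqsubset> s n"
  using assms(3)
proof (induction n)
  case (Suc n)
  then show ?case using assms trans by (metis less_Suc_eq)
qed simp

lemma increasing_inj:
  assumes "\<And>n. s n \<in> W" "\<And>n. s n \<sqsubset> s (Suc n)" "s m = s n"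
  shows "m = n"
  using increasing[of s m n] increasing[of s n m] assms irrefl by (metis linorder_neqE_nat)

text \<open>The least upper bound works: anything below it is not an upper bound, so the sequence
  passes it.\<close>

lemma limit_exists:
  assumes "s 0 = bot" and s: "\<And>n. s n \<in> W" "\<And>n. s n \<sqsubset> s (Suc n)"
  shows "\<exists>e\<in>W. ladder_for e s"
proof -
  define U where "U = {e \<in> W. \<forall>n. s n \<sqsubset> e}"
  have "s n \<sqsubset> top" for n
    using linear[OF s(1)[of n] top(1)] top(2)[OF s(1)[of "Suc n"]] s(2)[of n] top(2)[OF s(1)[of n]] by auto
  then have "U \<noteq> {}" using top by (auto simp: U_def)
  then obtain e where e: "e \<in> U" "\<And>y. y \<in> U \<Longrightarrow> \<not> y \<sqsubset> e"
    using least[of U] by (auto simp: U_def)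
  have "\<exists>n. y \<sqsubset> s n" if y: "y \<in> W" "y \<sqsubset> e" for y
  proof -
    obtain n where "\<not> s n \<sqsubset> y" using e(2) y by (auto simp: U_def)
    then have "s n = y \<or> y \<sqsubset> s n" using linear s y by blast
    then show ?thesis using s(2) by blast
  qed
  then show ?thesis using e s assms(1) by (auto simp: ladder_for_def U_def)
qed

text \<open>
  If \<open>x \<sqsubset> f x\<close>, then the iterates of \<open>f\<close> at \<open>x\<close> increase to a limit \<open>e\<close>. Below \<open>e\<close> the map \<open>f\<close> stays
  below \<open>e\<close>, so the ladder of \<open>f e\<close>, being the image of the ladder of \<open>e\<close>, cannot pass \<open>e\<close>. Hence \<open>f\<close>
  fixes \<open>e\<close> and its ladder, which is absurd as the ladder interleaves with the iterates.
\<close>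

theorem well_order_rigid:
  assumes f: "\<And>x. x \<in> W \<Longrightarrow> f x \<in> W"
    and mono: "\<And>x y. x \<in> W \<Longrightarrow> y \<in> W \<Longrightarrow> x \<sqsubset> y \<Longrightarrow> f x \<sqsubset> f y"
    and f_bot: "f bot = bot"
    and f_ladder: "\<And>e n. e \<in> limits \<Longrightarrow> f e \<in> limits \<and>
      (\<exists>m. f (ladder e n) = ladder (f e) m \<and> f (ladder e (Suc n)) = ladder (f e) (Suc m))"
    and x: "x \<in> W"
  shows "f x = x"
proof (rule ccontr)
  assume "f x \<noteq> x"
  \<comment> \<open>For a least counterexample \<open>z\<close>, monotonicity would make
    \<open>f z\<close> a smaller one.\<close>
  have ge: "\<not> f y \<sqsubset> y" if y: "y \<in> W" for y
  proof
    assume "f y \<sqsubset> y"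
    then obtain z where z: "z \<in> W" "f z \<sqsubset> z" "\<And>u. u \<in> W \<Longrightarrow> f u \<sqsubset> u \<Longrightarrow> \<not> u \<sqsubset> z"
      using least[of "{y \<in> W. f y \<sqsubset> y}"] y by auto
    then show False using mono[of "f z" z] f by blast
  qed
  have xf: "x \<sqsubset> f x" using ge[OF x] linear[OF x f[OF x]] \<open>f x \<noteq> x\<close> by auto
  define it where "it n = (f ^^ n) x" for n
  have it: "it n \<in> W" "it n \<sqsubset> it (Suc n)" for n
    by (induction n) (use x xf f mono in \<open>auto simp: it_def\<close>)
  \<comment> \<open>\<open>bot\<close> is put in front because a ladder has to start there.\<close>
  define s where "s n = (case n of 0 \<Rightarrow> bot | Suc m \<Rightarrow> it m)" for n
  have "bot \<sqsubset> x" using linear[OF bot(1) x] bot(2)[OF x] \<open>f x \<noteq> x\<close> f_bot by auto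
  then have "s n \<in> W" "s n \<sqsubset> s (Suc n)" for n
    using it bot by (cases n; simp add: s_def it_def)+
  then obtain e where e: "e \<in> W" "ladder_for e s"
    using limit_exists[of s] by (auto simp: s_def)
  then have lim: "e \<in> limits" by (auto simp: limits_def)
  have below: "\<exists>n. y \<sqsubset> it n" if y: "y \<in> W" "y \<sqsubset> e" for y
  proof -
    obtain n where "y \<sqsubset> s n" using e(2) y unfolding ladder_for_def by blast
    then show ?thesis using y bot by (cases n) (auto simp: s_def)
  qed
  have it_e: "it n \<sqsubset> e" for n
    using e(2) by (auto simp: ladder_for_def s_def dest: spec[of _ "Suc n"])
  have f_below: "f y \<sqsubset> e" if y: "y \<in> W" "y \<sqsubset> e" for y
  proof -
    obtain n where "y \<sqsubset> it n" using below y by blast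
    then have "f y \<sqsubset> it (Suc n)" using mono y it by (simp add: it_def)
    then show ?thesis using trans it_e it e f y by blast
  qed
  define z where "z = f e"
  have zl: "z \<in> limits" using f_ladder lim by (auto simp: z_def)
  note le = ladder[OF lim, unfolded ladder_for_def] and lz = ladder[OF zl, unfolded ladder_for_def]
  have zW: "z \<in> W" using zl by (auto simp: limits_def)
  \<comment> \<open>Consecutive rungs go to consecutive rungs and \<open>bot\<close> to
    \<open>bot\<close>, so the index cannot shift.\<close>
  have image: "f (ladder e n) = ladder z n" for n
  proof (induction n)
    case 0
    then show ?case using le lz f_bot by simp
  next
    case (Suc n)
    obtain m where m: "f (ladder e n) = ladder z m" "f (ladder e (Suc n)) = ladder z (Suc m)"
      using f_ladder[OF lim] by (auto simp: z_def)
    then have "ladder z m = ladder z n" using Suc by simp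
    then have "m = n" using increasing_inj[of "ladder z"] lz by blast
    then show ?case using m by simp
  qed
  have "\<not> e \<sqsubset> z"
  proof
    assume "e \<sqsubset> z"
    then obtain n where "e \<sqsubset> ladder z n" using lz e by blast
    moreover have "ladder z n \<sqsubset> e" using image f_below[of "ladder e n"] le by simp
    ultimately show False using trans irrefl e lz by blast
  qed
  then have z: "z = e" using ge[OF e(1)] linear[OF e(1) zW] unfolding z_def by metis
  \<comment> \<open>A rung above \<open>x\<close> is fixed by \<open>f\<close>, so by monotonicity
    it bounds all iterates, although these are cofinal in \<open>e\<close>.\<close>
  obtain n where n: "x \<sqsubset> ladder e n" using le it_e[of 0] x by (auto simp: it_def)
  have "it k \<sqsubset> ladder e n" for k
  proof (induction k)
    case (Suc k)
    then show ?case using mono[OF it(1) _ Suc] le image[of n] z by (simp add: it_def)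
  qed (use n in \<open>simp add: it_def\<close>)
  moreover obtain k where "ladder e n \<sqsubset> it k" using below le by blast
  ultimately show False using trans irrefl it le by blast
qed

end

lemma well_ordered_set_Some:
  fixes L :: "'l set"
  obtains less and bot where "well_ordered_set (insert None (Some ` L)) less bot (None :: 'l option)"
proof -
  obtain r where r: "well_order_on L r" using well_order_on by blast
  let ?W = "insert None (Some ` L)"
  define less where "less x y = (case x of None \<Rightarrow> False | Some a \<Rightarrow>
    (case y of None \<Rightarrow> True | Some b \<Rightarrow> (a, b) \<in> r \<and> a \<noteq> b))" for x y :: "'l option"
  have lin: "linear_order_on L r" and wf: "wf (r - Relation.Id)"
    using r by (auto simp: well_order_on_def)
  have least: "\<exists>x\<in>S. \<forall>y\<in>S. \<not> less y x" if S: "S \<subseteq> ?W" "S \<noteq> {}" for S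
  proof (cases "\<exists>a. Some a \<in> S")
    case True
    then obtain a where "a \<in> {a. Some a \<in> S}" by blast
    from wfE_min[OF wf this] obtain m where "Some m \<in> S" "\<And>b. (b, m) \<in> r - Relation.Id \<Longrightarrow> Some b \<notin> S" by auto
    then show ?thesis by (intro bexI[of _ "Some m"]) (auto simp: less_def split: option.splits)
  next
    case False
    then show ?thesis using S by (force simp: less_def)
  qed
  \<comment> \<open>If \<open>L\<close> is empty, \<open>bot\<close> is \<open>None\<close> and
    coincides with the greatest element.\<close>
  from least[of ?W] obtain bot where bot: "bot \<in> ?W" "\<forall>y\<in>?W. \<not> less y bot" by blast
  have r': "antisym r" "trans r" "total_on L r"
    using lin by (auto simp: linear_order_on_def partial_order_on_def preorder_on_def)
  have "well_ordered_set ?W less bot None"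
  proof
    show "\<exists>x\<in>S. \<forall>y\<in>S. \<not> less y x" if "S \<subseteq> ?W" "S \<noteq> {}" for S
      using that by (rule least)
  qed (use bot r' in \<open>auto simp: less_def total_on_def split: option.splits dest: antisymD transD\<close>)
  then show thesis using that by blast
qed

section \<open>Algebras as tuple systems\<close>

text \<open>A \<open>Term\<close> stands for a symbol applied to a whole family of arguments, which
  lets ternary tuples describe operations of any arity.\<close>

datatype ('u, 'w) element = Carrier 'u | Term 'u "'u \<Rightarrow> 'u" | Point 'w

text \<open>The domains of the tuples used below; entries and values of terms share one. They are
  pairwise disjoint and nonempty, hence an antichain.\<close>

definition positions :: "nat set set" where
  "positions = {{10}, {11}, {12, 13, 14}, {15, 16}, {17, 18, 19}, {20}}"

text \<open>The label \<open>(s, Some i)\<close> announces the entry at index \<open>i\<close>, and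
  \<open>(s, None)\<close> the value of the operation. The outer option supplies the greatest
  element.\<close>

locale algebra_encoding =
  well_ordered_set W less bot top
  for W :: "('u \<times> 'u option) option set" and less (infix "\<sqsubset>" 50) and bot top +
  fixes \<Delta> :: "'u algebra_type"
  assumes labels: "s \<in> symbols \<Delta> \<Longrightarrow> Some (s, None) \<in> W"
    "s \<in> symbols \<Delta> \<Longrightarrow> i \<in> arity \<Delta> s \<Longrightarrow> Some (s, Some i) \<in> W"
begin

text \<open>
  The positions, starting with 10, are vertices of the rigid graph below. Position 10 is open to all
  elements and so guarantees two positions for each of them; position 11 distinguishes the carrier,
  12 to 14 hold the operation tables, 15 and 16 the order of the labels, 17 to 19 their ladders and
  20 the least label.
\<close>

definition encoding_elems :: "'u algebra \<Rightarrow> ('u, ('u \<times> 'u option) option) element set" where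
  "encoding_elems A = Carrier ` carrier A \<union>
     {Term s x | s x. s \<in> symbols \<Delta> \<and> x \<in> arity \<Delta> s \<rightarrow>\<^sub>E carrier A} \<union> Point ` W"

definition encoding :: "'u algebra \<Rightarrow> ('u, ('u \<times> 'u option) option) element tuple_system" where
  "encoding A =
     \<lparr>elems = encoding_elems A,
      tuples =
        {[10 \<mapsto> v] | v. v \<in> encoding_elems A} \<union>
        {[11 \<mapsto> Carrier a] | a. a \<in> carrier A} \<union>
        {[12 \<mapsto> Term s x, 13 \<mapsto> Carrier (x i), 14 \<mapsto> Point (Some (s, Some i))] | s x i.
           s \<in> symbols \<Delta> \<and> x \<in> arity \<Delta> s \<rightarrow>\<^sub>E carrier A \<and> i \<in> arity \<Delta> s} \<union>
        {[12 \<mapsto> Term s x, 13 \<mapsto> Carrier (operation A s x), 14 \<mapsto> Point (Some (s, None))] | s x.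
           s \<in> symbols \<Delta> \<and> x \<in> arity \<Delta> s \<rightarrow>\<^sub>E carrier A} \<union>
        {[15 \<mapsto> Point u, 16 \<mapsto> Point v] | u v. u \<in> W \<and> v \<in> W \<and> u \<sqsubset> v} \<union>
        {[17 \<mapsto> Point e, 18 \<mapsto> Point (ladder e n), 19 \<mapsto> Point (ladder e (Suc n))] | e n. e \<in> limits} \<union>
        {[20 \<mapsto> Point bot]}\<rparr>"

lemma elems_encoding [simp]: "elems (encoding A) = encoding_elems A"
  by (simp add: encoding_def)

lemma tuples_at_11:
  assumes "\<tau> \<in> tuples (encoding A)" "\<tau> 11 = Some v"
  shows "\<exists>a\<in>carrier A. v = Carrier a"
  using assms by (auto simp: encoding_def split: if_splits)

lemma tuples_at_12:
  assumes "[12 \<mapsto> t, 13 \<mapsto> v, 14 \<mapsto> l] \<in> tuples (encoding A)"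
  shows "\<exists>s\<in>symbols \<Delta>. \<exists>x\<in>arity \<Delta> s \<rightarrow>\<^sub>E carrier A. t = Term s x \<and>
    (v = Carrier (operation A s x) \<and> l = Point (Some (s, None)) \<or>
     (\<exists>i\<in>arity \<Delta> s. v = Carrier (x i) \<and> l = Point (Some (s, Some i))))"
proof -
  define \<tau> where "\<tau> = [12 :: nat \<mapsto> t, 13 \<mapsto> v, 14 \<mapsto> l]"
  then have "\<tau> \<in> tuples (encoding A)" "\<tau> 12 = Some t" "\<tau> 13 = Some v" "\<tau> 14 = Some l"
    using assms by simp_all
  then show ?thesis unfolding encoding_def by (auto split: if_splits)
qed

lemma tuples_at_15:
  assumes "\<tau> \<in> tuples (encoding A)" "\<tau> 15 = Some x" "\<tau> 16 = Some y"
  shows "\<exists>u\<in>W. \<exists>v\<in>W. x = Point u \<and> y = Point v \<and> u \<sqsubset> v"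
  using assms by (auto simp: encoding_def split: if_splits)

lemma tuples_at_17:
  assumes "\<tau> \<in> tuples (encoding A)" "\<tau> 17 = Some x" "\<tau> 18 = Some y" "\<tau> 19 = Some z"
  shows "\<exists>e\<in>limits. \<exists>n. x = Point e \<and> y = Point (ladder e n) \<and> z = Point (ladder e (Suc n))"
  using assms unfolding encoding_def by (auto split: if_splits) blast

lemma tuples_at_20:
  assumes "\<tau> \<in> tuples (encoding A)" "\<tau> 20 = Some v"
  shows "v = Point bot"
  using assms by (auto simp: encoding_def split: if_splits)

lemma encoding_tuplesI:
  "v \<in> encoding_elems A \<Longrightarrow> [10 \<mapsto> v] \<in> tuples (encoding A)"
  "a \<in> carrier A \<Longrightarrow> [11 \<mapsto> Carrier a] \<in> tuples (encoding A)"
  "s \<in> symbols \<Delta> \<Longrightarrow> x \<in> arity \<Delta> s \<rightarrow>\<^sub>E carrier A \<Longrightarrow> i \<in> arity \<Delta> s \<Longrightarrow>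
    [12 \<mapsto> Term s x, 13 \<mapsto> Carrier (x i), 14 \<mapsto> Point (Some (s, Some i))] \<in> tuples (encoding A)"
  "s \<in> symbols \<Delta> \<Longrightarrow> x \<in> arity \<Delta> s \<rightarrow>\<^sub>E carrier A \<Longrightarrow>
    [12 \<mapsto> Term s x, 13 \<mapsto> Carrier (operation A s x), 14 \<mapsto> Point (Some (s, None))]
      \<in> tuples (encoding A)"
  "u \<in> W \<Longrightarrow> w \<in> W \<Longrightarrow> u \<sqsubset> w \<Longrightarrow> [15 \<mapsto> Point u, 16 \<mapsto> Point w] \<in> tuples (encoding A)"
  "e \<in> limits \<Longrightarrow> [17 \<mapsto> Point e, 18 \<mapsto> Point (ladder e n), 19 \<mapsto> Point (ladder e (Suc n))]
    \<in> tuples (encoding A)"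
  "[20 \<mapsto> Point bot] \<in> tuples (encoding A)"
  unfolding encoding_def tuple_system.select_convs by blast+

lemma encoding_tuple_cases:
  assumes "\<tau> \<in> tuples (encoding A)"
  obtains v where "\<tau> = [10 \<mapsto> v]" "v \<in> encoding_elems A"
    | a where "\<tau> = [11 \<mapsto> Carrier a]" "a \<in> carrier A"
    | s x i where "\<tau> = [12 \<mapsto> Term s x, 13 \<mapsto> Carrier (x i), 14 \<mapsto> Point (Some (s, Some i))]"
    "s \<in> symbols \<Delta>" "x \<in> arity \<Delta> s \<rightarrow>\<^sub>E carrier A" "i \<in> arity \<Delta> s"
    | s x where "\<tau> = [12 \<mapsto> Term s x, 13 \<mapsto> Carrier (operation A s x), 14 \<mapsto> Point (Some (s, None))]"
    "s \<in> symbols \<Delta>" "x \<in> arity \<Delta> s \<rightarrow>\<^sub>E carrier A"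
    | u v where "\<tau> = [15 \<mapsto> Point u, 16 \<mapsto> Point v]" "u \<in> W" "v \<in> W" "u \<sqsubset> v"
    | e n where "\<tau> = [17 \<mapsto> Point e, 18 \<mapsto> Point (ladder e n), 19 \<mapsto> Point (ladder e (Suc n))]" "e \<in> limits"
    | "\<tau> = [20 \<mapsto> Point bot]"
  using assms unfolding encoding_def by auto

lemma ladder_in_W: "e \<in> limits \<Longrightarrow> ladder e n \<in> W \<and> ladder e n \<sqsubset> e \<and> ladder e n \<sqsubset> ladder e (Suc n)"
  using ladder by (auto simp: ladder_for_def)

lemma bot_less: "w \<in> W \<Longrightarrow> w = bot \<or> bot \<sqsubset> w"
  using linear bot by blast

lemma gluable_encoding:
  assumes A: "algebra \<Delta> A"
  shows "gluable {10..20} positions (encoding A)"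
proof -
  have op: "operation A s x \<in> carrier A" if "s \<in> symbols \<Delta>" "x \<in> arity \<Delta> s \<rightarrow>\<^sub>E carrier A" for s x
    using A that by (auto simp: algebra_def PiE_iff)
  have le: "e \<in> W" if "e \<in> limits" for e using that by (auto simp: limits_def)
  have "dom \<tau> \<subseteq> {10..20} \<and> dom \<tau> \<in> positions \<and> ran \<tau> \<subseteq> encoding_elems A \<and> inj_on \<tau> (dom \<tau>)"
    if "\<tau> \<in> tuples (encoding A)" for \<tau>
  proof -
    from that show ?thesis
    proof (cases rule: encoding_tuple_cases)
      case (3 s x i)
      then show ?thesis
        using labels by (auto simp: positions_def encoding_elems_def inj_on_def PiE_iff insert_commute)
    next
      case (4 s x)
      then show ?thesis
        using labels op by (auto simp: positions_def encoding_elems_def inj_on_def insert_commute)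
    next
      case (5 u v)
      then show ?thesis
        using irrefl by (auto simp: positions_def encoding_elems_def inj_on_def insert_commute)
    next
      case (6 e n)
      then have "ladder e n \<noteq> e" "ladder e (Suc n) \<noteq> e" "ladder e n \<noteq> ladder e (Suc n)"
        using ladder_in_W irrefl le by metis+
      then show ?thesis
        using 6 le ladder_in_W
        by (auto simp: positions_def encoding_elems_def inj_on_def insert_commute)
    qed (auto simp: positions_def encoding_elems_def inj_on_def bot)
  qed
  moreover have "\<exists>\<tau>\<in>tuples (encoding A). \<exists>\<tau>'\<in>tuples (encoding A). \<exists>p q. p \<noteq> q \<and> \<tau> p = Some v \<and> \<tau>' q = Some v"
    if v: "v \<in> encoding_elems A" for v
  proof -
    have "[10 \<mapsto> v] \<in> tuples (encoding A)" using v by (rule encoding_tuplesI)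
    moreover have "\<exists>\<tau>\<in>tuples (encoding A). \<exists>q. 10 \<noteq> q \<and> \<tau> q = Some v"
    proof -
      \<comment> \<open>Position 10 is available to every element; a second one is 11 for carrier
        elements, 12 for terms (their value tuple exists even for empty arity), 20 for
        \<open>bot\<close> and 16 for points above it.\<close>
      consider a where "v = Carrier a" "a \<in> carrier A"
        | s x where "v = Term s x" "s \<in> symbols \<Delta>" "x \<in> arity \<Delta> s \<rightarrow>\<^sub>E carrier A"
        | "v = Point bot" | w where "v = Point w" "w \<in> W" "bot \<sqsubset> w"
        using v unfolding encoding_elems_def by (elim UnE imageE) (use bot_less in blast)+
      then show ?thesis
      proof cases
        case 1
        then have "[11 \<mapsto> v] \<in> tuples (encoding A)" by (simp add: encoding_tuplesI)
        then show ?thesis by (rule bexI[rotated]) (auto intro: exI[of _ 11])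
      next
        case (2 s x)
        then have "[12 \<mapsto> v, 13 \<mapsto> Carrier (operation A s x), 14 \<mapsto> Point (Some (s, None))] \<in> tuples (encoding A)"
          by (simp add: encoding_tuplesI)
        then show ?thesis by (rule bexI[rotated]) (auto intro: exI[of _ 12])
      next
        case 3
        then have "[20 \<mapsto> v] \<in> tuples (encoding A)" by (simp add: encoding_tuplesI)
        then show ?thesis by (rule bexI[rotated]) (auto intro: exI[of _ 20])
      next
        case 4
        then have "[15 \<mapsto> Point bot, 16 \<mapsto> v] \<in> tuples (encoding A)"
          using bot by (simp add: encoding_tuplesI)
        then show ?thesis by (rule bexI[rotated]) (auto intro: exI[of _ 16])
      qed
    qed
    ultimately show ?thesis by (metis fun_upd_same)
  qed
  ultimately show ?thesis by (auto simp: gluable_def encoding_def)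
qed

text \<open>Position 11 yields \<open>h\<close>, and \<open>well_order_rigid\<close> fixes all
  points. With fixed labels, the value tuple sends a term of \<open>s\<close> to a term of
  \<open>s\<close>, and the entry tuples force its arguments to be the images under
  \<open>h\<close>.\<close>

lemma encoding_hom:
  assumes A: "algebra \<Delta> A" and f: "f \<in> system_homs (encoding A) (encoding B)"
  obtains h where "h \<in> algebra_homs \<Delta> A B" "\<And>a. a \<in> carrier A \<Longrightarrow> f (Carrier a) = Carrier (h a)"
    "\<And>s x. s \<in> symbols \<Delta> \<Longrightarrow> x \<in> arity \<Delta> s \<rightarrow>\<^sub>E carrier A \<Longrightarrow> f (Term s x) = Term s (compose (arity \<Delta> s) h x)"
    "\<And>w. w \<in> W \<Longrightarrow> f (Point w) = Point w"
proof -
  have op: "operation A s x \<in> carrier A" if "s \<in> symbols \<Delta>" "x \<in> arity \<Delta> s \<rightarrow>\<^sub>E carrier A" for s x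
    using A that by (auto simp: algebra_def PiE_iff)
  have img: "map_option f \<circ> \<tau> \<in> tuples (encoding B)" if "\<tau> \<in> tuples (encoding A)" for \<tau>
    using f that by (auto simp: system_homs_def)
  have "\<exists>b\<in>carrier B. f (Carrier a) = Carrier b" if "a \<in> carrier A" for a
  proof -
    from tuples_at_11[OF img[OF encoding_tuplesI(2)[OF that]]] show ?thesis by simp
  qed
  then obtain h0 where h0: "\<And>a. a \<in> carrier A \<Longrightarrow> h0 a \<in> carrier B \<and> f (Carrier a) = Carrier (h0 a)"
    by metis
  define h where "h = restrict h0 (carrier A)"
  have h: "h a \<in> carrier B" "f (Carrier a) = Carrier (h a)" if "a \<in> carrier A" for a
    using h0 that by (auto simp: h_def)
  have f_bot: "f (Point bot) = Point bot"
    using tuples_at_20[OF img[OF encoding_tuplesI(7)]] by simp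
  have less: "\<exists>u'\<in>W. \<exists>v'\<in>W. f (Point u) = Point u' \<and> f (Point v) = Point v' \<and> u' \<sqsubset> v'"
    if "u \<in> W" "v \<in> W" "u \<sqsubset> v" for u v
    using tuples_at_15[OF img[OF encoding_tuplesI(5)[OF that]]] by simp
  have "\<exists>w'\<in>W. f (Point w) = Point w'" if "w \<in> W" for w
    using bot_less[OF that] f_bot bot(1) less[OF bot(1) that] by blast
  then obtain g where g: "\<And>w. w \<in> W \<Longrightarrow> g w \<in> W \<and> f (Point w) = Point (g w)" by metis
  have gfix: "g w = w" if "w \<in> W" for w
  proof (rule well_order_rigid[of g])
    show "g x \<sqsubset> g y" if "x \<in> W" "y \<in> W" "x \<sqsubset> y" for x y
      using less[OF that] g that by auto
    show "g bot = bot" using g bot f_bot by auto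
    show "g e \<in> limits \<and> (\<exists>m. g (ladder e n) = ladder (g e) m \<and> g (ladder e (Suc n)) = ladder (g e) (Suc m))"
      if e: "e \<in> limits" for e n
    proof -
      have "\<exists>e'\<in>limits. \<exists>m. f (Point e) = Point e' \<and> f (Point (ladder e n)) = Point (ladder e' m) \<and>
          f (Point (ladder e (Suc n))) = Point (ladder e' (Suc m))"
        by (rule tuples_at_17[OF img[OF encoding_tuplesI(6)[OF e, where n = n]]]) simp_all
      then obtain e' m where
        "e' \<in> limits" "f (Point e) = Point e'" "f (Point (ladder e n)) = Point (ladder e' m)"
        "f (Point (ladder e (Suc n))) = Point (ladder e' (Suc m))" by blast
      moreover have "e \<in> W" using e by (auto simp: limits_def)
      ultimately show ?thesis using g ladder_in_W[OF e] by auto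
    qed
  qed (use g that in auto)
  then have point: "f (Point w) = Point w" if "w \<in> W" for w using g that by auto
  have "f (Term s x) = Term s (compose (arity \<Delta> s) h x) \<and>
      h (operation A s x) = operation B s (compose (arity \<Delta> s) h x)"
    if s: "s \<in> symbols \<Delta>" and x: "x \<in> arity \<Delta> s \<rightarrow>\<^sub>E carrier A" for s x
  proof -
    have "[12 \<mapsto> f (Term s x), 13 \<mapsto> Carrier (h (operation A s x)), 14 \<mapsto> Point (Some (s, None))]
        \<in> tuples (encoding B)"
      using img[OF encoding_tuplesI(4)[OF s x]] point labels(1)[OF s] h op[OF s x] by simp
    from tuples_at_12[OF this] obtain y where y: "y \<in> arity \<Delta> s \<rightarrow>\<^sub>E carrier B"
      "f (Term s x) = Term s y" "h (operation A s x) = operation B s y"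
      by auto
    have "y i = h (x i)" if i: "i \<in> arity \<Delta> s" for i
    proof -
      have "[12 \<mapsto> Term s y, 13 \<mapsto> Carrier (h (x i)), 14 \<mapsto> Point (Some (s, Some i))] \<in> tuples (encoding B)"
        using img[OF encoding_tuplesI(3)[OF s x i]] point labels(2)[OF s i] h(2)[of "x i"] x i y(2)
        by (auto simp: PiE_iff)
      from tuples_at_12[OF this] show ?thesis by auto
    qed
    then have "y = compose (arity \<Delta> s) h x"
      using y(1) by (auto simp: compose_def fun_eq_iff PiE_iff extensional_def)
    then show ?thesis using y by simp
  qed
  moreover from this have "h \<in> algebra_homs \<Delta> A B"
    using h by (auto simp: algebra_homs_def h_def)
  ultimately show thesis using that h point by blast
qed

lemma encoding_lift:
  assumes h: "h \<in> algebra_homs \<Delta> A B" and A: "algebra \<Delta> A"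
  obtains f where "f \<in> system_homs (encoding A) (encoding B)"
    "\<And>a. a \<in> carrier A \<Longrightarrow> f (Carrier a) = Carrier (h a)"
proof -
  define f0 where "f0 v = (case v of Carrier a \<Rightarrow> Carrier (h a) |
    Term s x \<Rightarrow> Term s (compose (arity \<Delta> s) h x) | Point w \<Rightarrow> Point w)" for v :: "('u, ('u \<times> 'u option) option) element"
  have f0 [simp]: "f0 (Carrier a) = Carrier (h a)" "f0 (Term s x) = Term s (compose (arity \<Delta> s) h x)"
    "f0 (Point w) = Point w" for a s x w
    by (auto simp: f0_def)
  have hc: "h a \<in> carrier B" if "a \<in> carrier A" for a
    using h that by (auto simp: algebra_homs_def)
  have ht: "compose (arity \<Delta> s) h x \<in> arity \<Delta> s \<rightarrow>\<^sub>E carrier B" if "x \<in> arity \<Delta> s \<rightarrow>\<^sub>E carrier A" for s x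
    using hc that by (auto simp: compose_def PiE_iff)
  have hop: "h (operation A s x) = operation B s (compose (arity \<Delta> s) h x)"
    if "s \<in> symbols \<Delta>" "x \<in> arity \<Delta> s \<rightarrow>\<^sub>E carrier A" for s x
    using h that by (auto simp: algebra_homs_def)
  have elem: "f0 v \<in> encoding_elems B" if "v \<in> encoding_elems A" for v
    using that hc ht by (auto simp: encoding_elems_def)
  define f where "f = restrict f0 (encoding_elems A)"
  have tup: "map_option f0 \<circ> \<tau> \<in> tuples (encoding B)" if "\<tau> \<in> tuples (encoding A)" for \<tau>
  proof -
    from that show ?thesis
    proof (cases rule: encoding_tuple_cases)
      case (3 s x i)
      then have "h (x i) = compose (arity \<Delta> s) h x i" by (simp add: compose_def)
      then show ?thesis using encoding_tuplesI(3)[OF 3(2) ht[OF 3(3)] 3(4)] by (simp add: 3(1))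
    next
      case (4 s x)
      then show ?thesis using encoding_tuplesI(4)[OF 4(2) ht[OF 4(3)]] hop[OF 4(2,3)] by simp
    qed (use elem hc in \<open>simp_all add: encoding_tuplesI\<close>)
  qed
  \<comment> \<open>Homomorphisms are extensional, so \<open>f0\<close> is restricted; tuples hold
    only elements and do not notice.\<close>
  have "map_option f \<circ> \<tau> = map_option f0 \<circ> \<tau>" if "\<tau> \<in> tuples (encoding A)" for \<tau>
  proof -
    have "ran \<tau> \<subseteq> encoding_elems A" using gluable_encoding[OF A] that by (auto simp: gluable_def encoding_def)
    then show ?thesis by (force simp: f_def fun_eq_iff ran_def intro!: option.map_cong0 elim: option.set_cases)
  qed
  then have "f \<in> system_homs (encoding A) (encoding B)"
    using tup elem by (auto simp: system_homs_def f_def)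
  then show thesis using that by (auto simp: f_def encoding_elems_def)
qed

end

section \<open>Odd closed walks and full embeddings\<close>

lemma ordLess_finite:
  assumes "infinite (UNIV :: 'u set)" "finite X"
  shows "|X| <o |UNIV :: 'u set|"
  using assms by (meson card_of_ordLeq_finite card_of_Well_order not_ordLeq_iff_ordLess)

lemma ordLess_subset:
  assumes "X \<subseteq> Y" "|Y| <o r"
  shows "|X| <o r"
  using card_of_mono1[OF assms(1)] assms(2) by (rule ordLeq_ordLess_trans)

lemma ordLess_image: "|X| <o r \<Longrightarrow> |f ` X| <o r"
  using card_of_image by (rule ordLeq_ordLess_trans)

lemma ordLess_Times:
  assumes inf: "infinite (UNIV :: 'u set)"
    and X: "|X| <o |UNIV :: 'u set|" and Y: "|Y| <o |UNIV :: 'u set|"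
  shows "|X \<times> Y| <o |UNIV :: 'u set|"
proof (cases "finite (X <+> Y)")
  case True
  then show ?thesis by (intro ordLess_finite[OF inf]) auto
next
  case False
  have "|X \<times> Y| \<le>o |X <+> Y|"
    by (rule card_of_Sigma_ordLeq_infinite[OF False]) (simp_all add: card_of_Plus1 card_of_Plus2)
  then show ?thesis
    using card_of_Plus_ordLess_infinite[OF inf X Y] by (rule ordLeq_ordLess_trans)
qed

section \<open>Odd closed walks in non-bipartite graphs\<close>

lemma odd_closed_walk_if_not_bipartite:
  assumes G: "graph G" and "\<not> bipartite G"
  shows "\<exists>v n. odd n \<and> (v, v) \<in> edges G ^^ n"
proof (rule ccontr)
  let ?E = "edges G"
  assume "\<not> ?thesis"
  then have no: "\<not> odd n" if "(v, v) \<in> ?E ^^ n" for v n using that by blast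
  have sym: "sym ?E" using G by (simp add: graph_def)
  \<comment> \<open>A chosen vertex of the component of \<open>v\<close>. Adjacent vertices reach
    the same vertices, so the choice is made from the same set and agrees. The colouring is by the
    parity of a walk to it.\<close>
  define root where "root v = (SOME u. (v, u) \<in> ?E\<^sup>*)" for v
  have root: "(v, root v) \<in> ?E\<^sup>*" for v unfolding root_def by (rule someI[of _ v]) simp
  have root_eq: "root u = root v" if "(u, v) \<in> ?E" for u v
  proof -
    have "(u, w) \<in> ?E\<^sup>* \<longleftrightarrow> (v, w) \<in> ?E\<^sup>*" for w
      using that symD[OF sym that] by (meson converse_rtrancl_into_rtrancl)
    then show ?thesis by (simp add: root_def)
  qed
  define X where "X = {v \<in> verts G. \<exists>n. even n \<and> (v, root v) \<in> ?E ^^ n}"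
  have "(u \<in> X) \<noteq> (v \<in> X)" if e: "(u, v) \<in> ?E" for u v
  proof -
    obtain m where m: "(v, root v) \<in> ?E ^^ m" using root rtrancl_imp_relpow by metis
    have uv: "(u, root u) \<in> ?E ^^ Suc n" if "(v, root v) \<in> ?E ^^ n" for n
      using relpow_Suc_I2[OF e that] root_eq[OF e] by simp
    \<comment> \<open>One walk to the root followed by the other one reversed is closed, so the
      parity is well defined.\<close>
    have parity: "even (n + k)" if "(v, root v) \<in> ?E ^^ n" "(v, root v) \<in> ?E ^^ k" for n k
    proof -
      have "(v, v) \<in> ?E ^^ (n + k)"
        using that(1) relpow_symmetric[OF sym that(2)] unfolding relpow_add by blast
      then show ?thesis using no by blast
    qed
    have vu: "(v, root v) \<in> ?E ^^ Suc n" if "(u, root u) \<in> ?E ^^ n" for n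
      using relpow_Suc_I2[OF symD[OF sym e] that] root_eq[OF e] by simp
    have V: "u \<in> verts G" "v \<in> verts G" using e G by (auto simp: graph_def)
    show ?thesis
    proof (cases "even m")
      case True
      then have "v \<in> X" using m V by (auto simp: X_def)
      moreover have "u \<notin> X" using parity[OF m vu] True by (auto simp: X_def)
      ultimately show ?thesis by blast
    next
      case False
      then have "u \<in> X" using uv[OF m] V unfolding X_def by (auto intro: exI[of _ "Suc m"] simp del: relpow.simps)
      moreover have "v \<notin> X" using parity[OF m] False by (auto simp: X_def)
      ultimately show ?thesis by blast
    qed
  qed
  then have "edges G \<subseteq> X \<times> (verts G - X) \<union> (verts G - X) \<times> X"
    using G by (auto simp: graph_def)
  moreover have "X \<union> (verts G - X) = verts G" by (auto simp: X_def)
  ultimately have "bipartite G" unfolding bipartite_def by blast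
  then show False using assms(2) by blast
qed

text \<open>
  Every subdivided edge is wrapped around the closed walk; \<open>SOME\<close> only chooses a direction for it.
\<close>

lemma subdivision_to_closed_walk:
  assumes X: "graph X" and G: "graph G" and v: "(v, v) \<in> edges G ^^ (2 * r + 1)"
  shows "graph_homs (subdivision r X) G \<noteq> {}"
proof -
  obtain w where w: "w 0 = v" "w (2 * r + 1) = v" "\<And>i. i < 2 * r + 1 \<Longrightarrow> (w i, w (Suc i)) \<in> edges G"
    using v unfolding relpow_fun_conv by auto
  define fwd where "fwd x y \<longleftrightarrow> x = (SOME z. z \<in> {x, y})" for x y :: 'a
  have fwd: "fwd y x \<longleftrightarrow> \<not> fwd x y" if "x \<noteq> y" for x y
  proof -
    have "(SOME z. z \<in> {x, y}) \<in> {x, y}" by (rule someI[of _ x]) simp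
    moreover have "{x, y} = {y, x}" by auto
    ultimately show ?thesis using that unfolding fwd_def by auto
  qed
  \<comment> \<open>All branch vertices go to \<open>v\<close>, where the closed walk starts and
    ends, so the paths fit together in either direction.\<close>
  define \<phi> where "\<phi> = (\<lambda>(x, y, i). if i = 0 then v else if fwd x y then w i else w (2 * r + 1 - i))"
  have \<phi>_pt: "\<phi> (pt r x y i) = (if fwd x y then w i else w (2 * r + 1 - i))"
    if "(x, y) \<in> edges X" "i \<le> 2 * r + 1" for x y i
    using that fwd[of x y] edge_distinct[OF X that(1)] w(1,2) by (auto simp: pt_def \<phi>_def)
  have wV: "w i \<in> verts G" if "i \<le> 2 * r + 1" for i
    using w(3)[of "i - 1"] w(3)[of i] that G by (cases i) (auto simp: graph_def)
  have "\<phi> p \<in> verts G" if "p \<in> verts (subdivision r X)" for p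
    using that
  proof (cases rule: verts_subdivision_cases[OF X, consumes 1])
    case 1
    then show ?thesis using wV[of 0] w(1) by (auto simp: \<phi>_def)
  next
    case (2 x y i)
    then show ?thesis using \<phi>_pt[of x y i] wV by auto
  qed
  moreover have "(\<phi> p, \<phi> q) \<in> edges G" if pq: "(p, q) \<in> edges (subdivision r X)" for p q
  proof -
    obtain x y i where *: "(x, y) \<in> edges X" "i < 2 * r + 1" "p = pt r x y i" "q = pt r x y (Suc i)"
      using pq by (auto simp: subdivision_def)
    have "(w (Suc (2 * r - i)), w (2 * r - i)) \<in> edges G"
      using symD[of "edges G"] G w(3)[of "2 * r - i"] *(2) by (auto simp: graph_def)
    then show ?thesis
      using *(2) w(3)[OF *(2)] \<phi>_pt[OF *(1), of i] \<phi>_pt[OF *(1), of "Suc i"]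
      unfolding *(3,4) by (auto simp: Suc_diff_le)
  qed
  moreover have "p \<in> verts (subdivision r X) \<and> q \<in> verts (subdivision r X)"
    if "(p, q) \<in> edges (subdivision r X)" for p q
    using that graph_subdivision[OF X, of r] by (auto simp: graph_def)
  ultimately have "restrict \<phi> (verts (subdivision r X)) \<in> graph_homs (subdivision r X) G"
    by (auto simp: graph_homs_def)
  then show ?thesis by blast
qed

section \<open>Transport of graphs along injections\<close>

definition map_graph :: "('x \<Rightarrow> 'y) \<Rightarrow> 'x graph \<Rightarrow> 'y graph" where
  "map_graph e H = \<lparr>verts = e ` verts H, edges = map_prod e e ` edges H\<rparr>"

lemma graph_map_graph:
  assumes "graph H" "inj_on e (verts H)"
  shows "graph (map_graph e H)"
proof -
  have V: "u \<in> verts H \<and> v \<in> verts H" if "(u, v) \<in> edges H" for u v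
    using assms(1) that by (auto simp: graph_def)
  have "irrefl (edges (map_graph e H))"
  proof (rule irreflI, rule notI)
    fix y assume "(y, y) \<in> edges (map_graph e H)"
    then obtain u v where "(u, v) \<in> edges H" "e u = e v" by (auto simp: map_graph_def)
    then have "(u, u) \<in> edges H" using V inj_onD[OF assms(2), of u v] by auto
    then show False using assms(1) by (auto simp: graph_def irrefl_def)
  qed
  moreover have "sym (edges (map_graph e H))"
    using assms(1) by (force simp: map_graph_def graph_def sym_def)
  moreover have "edges (map_graph e H) \<subseteq> verts (map_graph e H) \<times> verts (map_graph e H)"
    using V by (auto simp: map_graph_def)
  ultimately show ?thesis by (simp add: graph_def)
qed

lemma graph_homs_map_graphD:
  assumes H: "graph H" and H': "graph H'" and inj: "inj_on e' (verts H')"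
    and F: "F \<in> graph_homs (map_graph e H) (map_graph e' H')"
  obtains F0 where "F0 \<in> graph_homs H H'" "\<And>x. x \<in> verts H \<Longrightarrow> F (e x) = e' (F0 x)"
proof -
  have "\<exists>y\<in>verts H'. F (e x) = e' y" if "x \<in> verts H" for x
    using F that by (auto simp: graph_homs_def map_graph_def)
  then obtain g where g: "\<And>x. x \<in> verts H \<Longrightarrow> g x \<in> verts H' \<and> F (e x) = e' (g x)" by metis
  have V: "u \<in> verts H \<and> v \<in> verts H" if "(u, v) \<in> edges H" for u v
    using H that by (auto simp: graph_def)
  have V': "u \<in> verts H' \<and> v \<in> verts H'" if "(u, v) \<in> edges H'" for u v
    using H' that by (auto simp: graph_def)
  have "(g u, g v) \<in> edges H'" if uv: "(u, v) \<in> edges H" for u v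
  proof -
    have "(F (e u), F (e v)) \<in> edges (map_graph e' H')"
      using F uv by (force simp: graph_homs_def map_graph_def)
    then obtain a b where "(a, b) \<in> edges H'" "e' a = e' (g u)" "e' b = e' (g v)"
      using g V[OF uv] by (auto simp: map_graph_def)
    then show ?thesis using inj_onD[OF inj] g V[OF uv] V' by metis
  qed
  then have "restrict g (verts H) \<in> graph_homs H H'"
    using g V by (auto simp: graph_homs_def)
  then show thesis using that g by (metis restrict_apply')
qed

lemma graph_homs_map_graphI:
  assumes H: "graph H" and inj: "inj_on e (verts H)" and F: "F \<in> graph_homs H H'"
  obtains F1 where "F1 \<in> graph_homs (map_graph e H) (map_graph e' H')" "\<And>x. x \<in> verts H \<Longrightarrow> F1 (e x) = e' (F x)"
proof -
  define F1 where "F1 = (\<lambda>y\<in>e ` verts H. e' (F (inv_into (verts H) e y)))"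
  have F1: "F1 (e x) = e' (F x)" if "x \<in> verts H" for x
    using that inj by (simp add: F1_def)
  moreover have "F1 \<in> graph_homs (map_graph e H) (map_graph e' H')"
  proof -
    have "F1 \<in> verts (map_graph e H) \<rightarrow>\<^sub>E verts (map_graph e' H')"
      using F inj by (auto simp: F1_def map_graph_def graph_homs_def)
    moreover have "(F1 (e u), F1 (e v)) \<in> edges (map_graph e' H')" if uv: "(u, v) \<in> edges H" for u v
    proof -
      have "u \<in> verts H" "v \<in> verts H" using H uv by (auto simp: graph_def)
      moreover have "(F u, F v) \<in> edges H'" using F uv by (auto simp: graph_homs_def)
      ultimately show ?thesis using F1 by (force simp: map_graph_def)
    qed
    ultimately show ?thesis by (auto simp: graph_homs_def map_graph_def)
  qed
  ultimately show thesis using that by blast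
qed

section \<open>Construction and composition of full embeddings\<close>

lemma full_embedding_full_subcategory:
  assumes "full_embedding C D F F'" "S \<subseteq> Obj C"
  shows "full_embedding (full_subcategory C S) D F F'"
proof -
  interpret category_functor C D F F' using assms(1) by (simp add: full_embedding_def)
  have S: "a \<in> S \<Longrightarrow> a \<in> Obj C" for a using assms(2) by blast
  have cat: "category (full_subcategory C S)"
    using C.category_axioms assms(2) by (rule category_full_subcategory)
  have "category_functor (full_subcategory C S) D F F'"
    unfolding category_functor_def category_functor_axioms_def
    using cat D.category_axioms S F_Obj F'_Hom F'_Id F'_Comp by (simp add: full_subcategory_def)
  then show ?thesis
    using assms S by (auto simp: full_embedding_def full_subcategory_def intro: inj_on_subset)
qed

lemma full_embedding_after_isomorphism:
  assumes iso: "isomorphic_categories B C" and emb: "full_embedding C D G G'"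
  shows "\<exists>F F'. full_embedding B D F F'"
proof -
  obtain I I' where I: "category_functor B C I I'" "bij_betw I (Obj B) (Obj C)"
    "\<And>a b. a \<in> Obj B \<Longrightarrow> b \<in> Obj B \<Longrightarrow> bij_betw (I' a b) (Hom B a b) (Hom C (I a) (I b))"
    using iso by (auto simp: isomorphic_categories_def)
  interpret I: category_functor B C I I' by (rule I(1))
  interpret G: category_functor C D G G' using emb by (simp add: full_embedding_def)
  have "category_functor B D (G \<circ> I) (\<lambda>a b f. G' (I a) (I b) (I' a b f))"
    by unfold_locales
      (simp_all add: I.F_Obj I.F'_Hom I.F'_Id I.F'_Comp G.F_Obj G.F'_Hom G.F'_Id G.F'_Comp)
  moreover have "inj_on (G \<circ> I) (Obj B)"
    using I(2) emb by (auto simp: full_embedding_def bij_betw_def intro: comp_inj_on)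
  moreover have "inj_on (\<lambda>f. G' (I a) (I b) (I' a b f)) (Hom B a b) \<and>
      (\<lambda>f. G' (I a) (I b) (I' a b f)) ` Hom B a b = Hom D (G (I a)) (G (I b))"
    if ab: "a \<in> Obj B" "b \<in> Obj B" for a b
  proof -
    have "inj_on (G' (I a) (I b)) (Hom C (I a) (I b))"
      "G' (I a) (I b) ` Hom C (I a) (I b) = Hom D (G (I a)) (G (I b))"
      using emb I.F_Obj ab by (auto simp: full_embedding_def)
    moreover have "inj_on (I' a b) (Hom B a b)" "I' a b ` Hom B a b = Hom C (I a) (I b)"
      using I(3)[OF ab] by (auto simp: bij_betw_def)
    ultimately show ?thesis
      using comp_inj_on[of "I' a b" "Hom B a b" "G' (I a) (I b)"] by (simp add: comp_def image_image[symmetric])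
  qed
  ultimately have "full_embedding B D (G \<circ> I) (\<lambda>a b f. G' (I a) (I b) (I' a b f))"
    by (simp add: full_embedding_def)
  then show ?thesis by blast
qed

text \<open>
  Since every homomorphism is determined by its values on the vertices \<open>tag a\<close>, functoriality is
  automatic. These vertices also make the functor injective on objects: if two algebras have the
  same graph, then its identity map comes from the identity of the carrier.
\<close>

lemma full_embedding_of_representation:
  fixes \<Delta> :: "'u algebra_type" and \<Gamma> :: "'u algebra \<Rightarrow> 'u graph" and G :: "'v graph"
  assumes tag: "inj tag"
    and obj: "\<And>A. A \<in> Obj (Alg \<Delta>) \<Longrightarrow> \<Gamma> A \<in> Obj (Gra_to G)"
    and vert: "\<And>A a. A \<in> Obj (Alg \<Delta>) \<Longrightarrow> tag a \<in> verts (\<Gamma> A) \<longleftrightarrow> a \<in> carrier A"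
    and hom: "\<And>A B F. A \<in> Obj (Alg \<Delta>) \<Longrightarrow> B \<in> Obj (Alg \<Delta>) \<Longrightarrow> F \<in> graph_homs (\<Gamma> A) (\<Gamma> B) \<Longrightarrow>
      \<exists>h\<in>algebra_homs \<Delta> A B. \<forall>a\<in>carrier A. F (tag a) = tag (h a)"
    and lift: "\<And>A B h. A \<in> Obj (Alg \<Delta>) \<Longrightarrow> B \<in> Obj (Alg \<Delta>) \<Longrightarrow> h \<in> algebra_homs \<Delta> A B \<Longrightarrow>
      \<exists>F\<in>graph_homs (\<Gamma> A) (\<Gamma> B). \<forall>a\<in>carrier A. F (tag a) = tag (h a)"
    and unique: "\<And>A B F F'. A \<in> Obj (Alg \<Delta>) \<Longrightarrow> B \<in> Obj (Alg \<Delta>) \<Longrightarrow>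
      F \<in> graph_homs (\<Gamma> A) (\<Gamma> B) \<Longrightarrow> F' \<in> graph_homs (\<Gamma> A) (\<Gamma> B) \<Longrightarrow>
      (\<And>a. a \<in> carrier A \<Longrightarrow> F (tag a) = F' (tag a)) \<Longrightarrow> F = F'"
  shows "\<exists>F'. full_embedding (Alg \<Delta>) (Gra_to G) \<Gamma> F'"
proof -
  define \<Phi> where "\<Phi> A B h =
    (THE F. F \<in> graph_homs (\<Gamma> A) (\<Gamma> B) \<and> (\<forall>a\<in>carrier A. F (tag a) = tag (h a)))" for A B h
  have \<Phi>: "\<Phi> A B h \<in> graph_homs (\<Gamma> A) (\<Gamma> B) \<and> (\<forall>a\<in>carrier A. \<Phi> A B h (tag a) = tag (h a))"
    if AB: "A \<in> Obj (Alg \<Delta>)" "B \<in> Obj (Alg \<Delta>)" and h: "h \<in> algebra_homs \<Delta> A B" for A B h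
  proof -
    have "\<exists>!F. F \<in> graph_homs (\<Gamma> A) (\<Gamma> B) \<and> (\<forall>a\<in>carrier A. F (tag a) = tag (h a))"
    proof (rule ex_ex1I)
      show "\<exists>F. F \<in> graph_homs (\<Gamma> A) (\<Gamma> B) \<and> (\<forall>a\<in>carrier A. F (tag a) = tag (h a))"
        using lift[OF AB h] by blast
      show "F = F'" if "F \<in> graph_homs (\<Gamma> A) (\<Gamma> B) \<and> (\<forall>a\<in>carrier A. F (tag a) = tag (h a))"
        "F' \<in> graph_homs (\<Gamma> A) (\<Gamma> B) \<and> (\<forall>a\<in>carrier A. F' (tag a) = tag (h a))" for F F'
        using that by (intro unique[OF AB]) simp_all
    qed
    then show ?thesis unfolding \<Phi>_def by (rule theI')
  qed
  have \<Phi>I: "\<Phi> A B h = F" if "A \<in> Obj (Alg \<Delta>)" "B \<in> Obj (Alg \<Delta>)" "h \<in> algebra_homs \<Delta> A B"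
    "F \<in> graph_homs (\<Gamma> A) (\<Gamma> B)" "\<And>a. a \<in> carrier A \<Longrightarrow> F (tag a) = tag (h a)" for A B h F
    using \<Phi>[OF that(1-3)] that(4,5) by (intro unique[OF that(1,2)]) simp_all
  have Hom_Alg: "Hom (Alg \<Delta>) A B = algebra_homs \<Delta> A B" for A B by (simp add: Alg_def)
  have Hom_Gra: "Hom (Gra_to G) H K = graph_homs H K" for H K :: "'u graph"
    by (simp add: Gra_to_def full_subcategory_def Gra_def)
  have Id_Gra: "Id (Gra_to G) H = (\<lambda>x\<in>verts H. x)" for H :: "'u graph"
    by (simp add: Gra_to_def full_subcategory_def Gra_def)
  have Comp_Gra: "Comp (Gra_to G) H K L g f = compose (verts H) g f" for H K L :: "'u graph" and f g
    by (simp add: Gra_to_def full_subcategory_def Gra_def)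
  interpret A: category "Alg \<Delta>" by (rule category_Alg)
  interpret G: category "Gra_to G :: ('u graph, 'u \<Rightarrow> 'u) category" by (rule category_Gra_to)
  have Id: "\<Phi> A A (Id (Alg \<Delta>) A) = Id (Gra_to G) (\<Gamma> A)" if A: "A \<in> Obj (Alg \<Delta>)" for A
    using A.Id_in_Hom[OF A] G.Id_in_Hom[OF obj[OF A]] vert[OF A] A
    by (intro \<Phi>I) (auto simp: Hom_Alg Hom_Gra Id_Gra Alg_def)
  have "category_functor (Alg \<Delta>) (Gra_to G) \<Gamma> \<Phi>"
  proof
    fix A B C f g
    assume *: "A \<in> Obj (Alg \<Delta>)" "B \<in> Obj (Alg \<Delta>)" "C \<in> Obj (Alg \<Delta>)"
      and f: "f \<in> Hom (Alg \<Delta>) A B" and g: "g \<in> Hom (Alg \<Delta>) B C"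
    have f': "f a \<in> carrier B" if "a \<in> carrier A" for a
      using f that by (auto simp: Hom_Alg algebra_homs_def)
    have F: "\<Phi> A B f \<in> Hom (Gra_to G) (\<Gamma> A) (\<Gamma> B)" "\<Phi> B C g \<in> Hom (Gra_to G) (\<Gamma> B) (\<Gamma> C)"
      using \<Phi> * f g by (auto simp: Hom_Alg Hom_Gra)
    show "\<Phi> A C (Comp (Alg \<Delta>) A B C g f) = Comp (Gra_to G) (\<Gamma> A) (\<Gamma> B) (\<Gamma> C) (\<Phi> B C g) (\<Phi> A B f)"
    proof (rule \<Phi>I[OF *(1,3)])
      show "Comp (Alg \<Delta>) A B C g f \<in> algebra_homs \<Delta> A C"
        using A.Comp_in_Hom[OF * f g] by (simp add: Hom_Alg)
      show "Comp (Gra_to G) (\<Gamma> A) (\<Gamma> B) (\<Gamma> C) (\<Phi> B C g) (\<Phi> A B f) \<in> graph_homs (\<Gamma> A) (\<Gamma> C)"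
        using G.Comp_in_Hom[OF obj obj obj F] * by (simp add: Hom_Gra)
      show "Comp (Gra_to G) (\<Gamma> A) (\<Gamma> B) (\<Gamma> C) (\<Phi> B C g) (\<Phi> A B f) (tag a) = tag (Comp (Alg \<Delta>) A B C g f a)"
        if "a \<in> carrier A" for a
        using that \<Phi>[OF *(1,2)] \<Phi>[OF *(2,3)] f g f' vert[OF *(1)]
        by (simp add: Comp_Gra Alg_def compose_eq)
    qed
  qed (use \<Phi> obj Id in \<open>simp_all add: Hom_Alg Hom_Gra\<close>)
  moreover have "inj_on \<Gamma> (Obj (Alg \<Delta>))"
  proof (rule inj_onI)
    fix A B assume AB: "A \<in> Obj (Alg \<Delta>)" "B \<in> Obj (Alg \<Delta>)" and eq: "\<Gamma> A = \<Gamma> B"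
    have carrier: "carrier A = carrier B"
      using vert[OF AB(1)] vert[OF AB(2)] eq by (intro set_eqI) simp
    have "Id (Gra_to G) (\<Gamma> A) \<in> graph_homs (\<Gamma> A) (\<Gamma> B)"
      using G.Id_in_Hom[OF obj[OF AB(1)]] eq by (simp add: Hom_Gra)
    from hom[OF AB this] obtain h where h: "h \<in> algebra_homs \<Delta> A B"
      "\<forall>a\<in>carrier A. Id (Gra_to G) (\<Gamma> A) (tag a) = tag (h a)" by (elim bexE)
    then have h_id: "h a = a" if "a \<in> carrier A" for a
      using that vert[OF AB(1)] inj_eq[OF tag] by (simp add: Id_Gra)
    have A: "algebra \<Delta> A" and B: "algebra \<Delta> B" using AB by (auto simp: Alg_def)
    have "operation A s x = operation B s x" for s x
    proof (cases "s \<in> symbols \<Delta> \<and> x \<in> arity \<Delta> s \<rightarrow>\<^sub>E carrier A")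
      case True
      then have "compose (arity \<Delta> s) h x = x"
        using h_id by (auto simp: compose_def PiE_iff fun_eq_iff extensional_def)
      moreover have "operation A s x \<in> carrier A" using A True by (auto simp: algebra_def PiE_iff)
      moreover have "h (operation A s x) = operation B s (compose (arity \<Delta> s) h x)"
        using h(1) True by (simp add: algebra_homs_def)
      ultimately show ?thesis using h_id by simp
    next
      \<comment> \<open>Here both operations are off their domain and take the default value that
        extensionality prescribes.\<close>
      case False
      show ?thesis
      proof (cases "s \<in> symbols \<Delta>")
        case True
        then have "operation A s \<in> (arity \<Delta> s \<rightarrow>\<^sub>E carrier A) \<rightarrow>\<^sub>E carrier A"
          "operation B s \<in> (arity \<Delta> s \<rightarrow>\<^sub>E carrier A) \<rightarrow>\<^sub>E carrier A"
          using PiE_mem[OF A[unfolded algebra_def] True] PiE_mem[OF B[unfolded algebra_def] True] carrier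
          by simp_all
        then show ?thesis using True False PiE_arb by metis
      next
        case False
        then show ?thesis using A B PiE_arb unfolding algebra_def by metis
      qed
    qed
    then have "operation A = operation B" by auto
    then show "A = B" using carrier by simp
  qed
  moreover have "inj_on (\<Phi> A B) (Hom (Alg \<Delta>) A B)"
    if AB: "A \<in> Obj (Alg \<Delta>)" "B \<in> Obj (Alg \<Delta>)" for A B
  proof (rule inj_onI)
    fix h k assume hk: "h \<in> Hom (Alg \<Delta>) A B" "k \<in> Hom (Alg \<Delta>) A B" "\<Phi> A B h = \<Phi> A B k"
    then have "h a = k a" if "a \<in> carrier A" for a
      using \<Phi>[OF AB, of h] \<Phi>[OF AB, of k] that by (simp add: Hom_Alg inj_eq[OF tag])
    then show "h = k" using hk by (auto simp: Hom_Alg algebra_homs_def intro: PiE_ext)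
  qed
  moreover have "\<Phi> A B ` Hom (Alg \<Delta>) A B = Hom (Gra_to G) (\<Gamma> A) (\<Gamma> B)"
    if AB: "A \<in> Obj (Alg \<Delta>)" "B \<in> Obj (Alg \<Delta>)" for A B
  proof
    show "\<Phi> A B ` Hom (Alg \<Delta>) A B \<subseteq> Hom (Gra_to G) (\<Gamma> A) (\<Gamma> B)"
      using \<Phi>[OF AB] by (auto simp: Hom_Alg Hom_Gra)
    show "Hom (Gra_to G) (\<Gamma> A) (\<Gamma> B) \<subseteq> \<Phi> A B ` Hom (Alg \<Delta>) A B"
    proof
      fix F assume "F \<in> Hom (Gra_to G) (\<Gamma> A) (\<Gamma> B)"
      then have F: "F \<in> graph_homs (\<Gamma> A) (\<Gamma> B)" by (simp add: Hom_Gra)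
      from hom[OF AB F] obtain h where h: "h \<in> algebra_homs \<Delta> A B"
        "\<forall>a\<in>carrier A. F (tag a) = tag (h a)" by (elim bexE)
      then have "\<Phi> A B h = F" by (intro \<Phi>I[OF AB _ F]) simp_all
      then show "F \<in> \<Phi> A B ` Hom (Alg \<Delta>) A B" using h(1) by (auto simp: Hom_Alg)
    qed
  qed
  ultimately have "full_embedding (Alg \<Delta>) (Gra_to G) \<Gamma> \<Phi>" by (simp add: full_embedding_def)
  then show ?thesis by blast
qed

section \<open>A finite rigid graph\<close>

text \<open>
  Found by computer search: random \<open>K\<^sub>5\<close>-free graphs on the core \<open>0, \<dots>, 9\<close>, with a new vertex joined
  to each of eleven maximal triangles. Only these new vertices are used as positions of tuples.
\<close>

definition gadget_rows :: "nat list list" where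
  "gadget_rows =
    [[1, 2, 3, 4, 5, 6],
     [0, 2, 3, 6, 7, 8, 13, 18],
     [0, 1, 3, 4, 5, 6, 7, 12],
     [0, 1, 2, 4, 7, 9, 14, 19],
     [0, 2, 3, 5, 8, 9, 11, 19, 20],
     [0, 2, 4, 6, 7, 8, 10, 12, 16, 20],
     [0, 1, 2, 5, 8, 9, 10, 13, 15],
     [1, 2, 3, 5, 8, 9, 12, 14, 16, 17, 18],
     [1, 4, 5, 6, 7, 9, 10, 11, 13, 15, 16, 17, 18, 20],
     [3, 4, 6, 7, 8, 11, 14, 15, 17, 19],
     [5, 6, 8],
     [4, 8, 9],
     [2, 5, 7],
     [1, 6, 8],
     [3, 7, 9],
     [6, 8, 9],
     [5, 7, 8],
     [7, 8, 9],
     [1, 7, 8],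
     [3, 4, 9],
     [4, 5, 8]]"

definition gadget_edges :: "(nat \<times> nat) set" where
  "gadget_edges = {(p, q). p < 21 \<and> q \<in> set (gadget_rows ! p)}"

definition gadget_masks :: "bool list list" where
  "gadget_masks = map (\<lambda>r. map (\<lambda>q. q \<in> set r) [0..<21]) gadget_rows"

text \<open>Only neighbours that are mapped before \<open>k\<close> constrain its image; the row is
  reversed because the images are listed latest first.\<close>

definition earlier_masks :: "bool list list" where
  "earlier_masks = map (\<lambda>k. rev (take k (gadget_masks ! k))) [0..<21]"

fun select :: "bool list \<Rightarrow> 'a list \<Rightarrow> 'a list" where
  "select (True # bs) (x # xs) = x # select bs xs"
| "select (False # bs) (x # xs) = select bs xs"
| "select _ _ = []"

text \<open>
  Backtracking over the images of the vertices, latest first; an image is represented by its row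
  in the adjacency matrix \<open>ms\<close>, which keeps the evaluation by rewriting cheap. The second argument
  marks the earlier neighbours of the vertices still to be mapped.
\<close>

fun only_identity :: "bool list list \<Rightarrow> bool list list \<Rightarrow> bool list list \<Rightarrow> bool" where
  "only_identity ms [] xs \<longleftrightarrow> xs = rev ms"
| "only_identity ms (s # ss) xs \<longleftrightarrow> list_all (only_identity ms ss) (map (\<lambda>m. m # xs)
     (select (fold (map2 (\<and>)) (select s xs) (replicate 21 True)) ms))"

lemma in_select:
  "i < length bs \<Longrightarrow> i < length xs \<Longrightarrow> bs ! i \<Longrightarrow> xs ! i \<in> set (select bs xs)"
proof (induction bs xs arbitrary: i rule: select.induct)
  case (1 bs x xs)
  then show ?case by (cases i) auto
next
  case (2 bs x xs)
  then show ?case by (cases i) auto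
qed auto

lemma set_select: "set (select bs xs) \<subseteq> {xs ! i | i. i < length bs \<and> i < length xs \<and> bs ! i}"
proof (induction bs xs rule: select.induct)
  case (1 bs x xs)
  then show ?case by (fastforce intro: exI[of _ 0] exI[of _ "Suc _"])
next
  case (2 bs x xs)
  then show ?case by (fastforce intro: exI[of _ "Suc _"])
qed auto

lemma fold_map2_conj:
  assumes "\<And>r. r \<in> set rs \<Longrightarrow> length r = length acc"
  shows "length (fold (map2 (\<and>)) rs acc) = length acc \<and>
    (\<forall>i<length acc. fold (map2 (\<and>)) rs acc ! i \<longleftrightarrow> acc ! i \<and> (\<forall>r\<in>set rs. r ! i))"
  using assms by (induction rs arbitrary: acc) auto

lemma length_gadget_masks: "length gadget_masks = 21" "length earlier_masks = 21"
  by (simp_all add: gadget_masks_def gadget_rows_def earlier_masks_def del: upt_rec_numeral)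

lemma gadget_mask_nth:
  assumes "p < 21"
  shows "length (gadget_masks ! p) = 21" "q < 21 \<Longrightarrow> gadget_masks ! p ! q \<longleftrightarrow> (p, q) \<in> gadget_edges"
proof -
  have "p < length gadget_rows" using assms by (simp add: gadget_rows_def)
  then show "length (gadget_masks ! p) = 21" "q < 21 \<Longrightarrow> gadget_masks ! p ! q \<longleftrightarrow> (p, q) \<in> gadget_edges"
    using assms by (simp_all add: gadget_masks_def gadget_edges_def del: upt_rec_numeral)
qed

text \<open>The search never prunes a homomorphism \<open>g\<close>: the image of \<open>k\<close>
  is adjacent to the images of the earlier neighbours of \<open>k\<close>, hence among the
  candidates. So the branch given by \<open>g\<close> survives to a leaf, where it is compared with
  the identity.\<close>

lemma only_identity_sound:
  assumes "only_identity gadget_masks (drop k earlier_masks) (map (\<lambda>p. gadget_masks ! g p) (rev [0..<k]))"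
    and "k \<le> 21"
    and g: "\<And>p. p < 21 \<Longrightarrow> g p < 21" "\<And>p q. (p, q) \<in> gadget_edges \<Longrightarrow> (g p, g q) \<in> gadget_edges"
    and sym: "sym gadget_edges"
  shows "map (\<lambda>p. gadget_masks ! g p) (rev [0..<21]) = rev gadget_masks"
  using assms(2,1)
proof (induction k rule: inc_induct)
  case base
  then show ?case using length_gadget_masks by simp
next
  case (step k)
  let ?xs = "map (\<lambda>p. gadget_masks ! g p) (rev [0..<k])" and ?s = "rev (take k (gadget_masks ! k))"
  let ?c = "fold (map2 (\<and>)) (select ?s ?xs) (replicate 21 True)"
  have drop: "drop k earlier_masks = ?s # drop (Suc k) earlier_masks"
    using step.hyps length_gadget_masks
    by (simp add: Cons_nth_drop_Suc[symmetric] earlier_masks_def del: upt_rec_numeral)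
  \<comment> \<open>Both lists are reversed, so index \<open>i\<close> refers to vertex
    \<open>k - Suc i\<close> in each of them.\<close>
  have sel: "\<exists>p<k. (p, k) \<in> gadget_edges \<and> r = gadget_masks ! g p" if r: "r \<in> set (select ?s ?xs)" for r
  proof -
    obtain i where i: "i < k" "?s ! i" "r = ?xs ! i"
      using set_select[of ?s ?xs] r step.hyps gadget_mask_nth(1)[of k] by auto
    have "?s ! i = gadget_masks ! k ! (k - Suc i)"
      using i(1) step.hyps gadget_mask_nth(1)[of k] by (simp add: rev_nth)
    moreover have "?xs ! i = gadget_masks ! g (k - Suc i)"
      using i(1) by (simp add: rev_nth)
    ultimately show ?thesis
      using i step.hyps gadget_mask_nth(2)[of k "k - Suc i"] symD[OF sym]
      by (intro exI[of _ "k - Suc i"]) auto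
  qed
  have k: "k < 21" "g k < 21" using step.hyps g(1) by auto
  have fold: "length ?c = 21" "?c ! g k \<longleftrightarrow> (\<forall>r\<in>set (select ?s ?xs). r ! g k)"
    using fold_map2_conj[of "select ?s ?xs" "replicate 21 True"] sel gadget_mask_nth(1) g(1) k
    by fastforce+
  have "r ! g k" if r: "r \<in> set (select ?s ?xs)" for r
  proof -
    obtain p where "p < k" "(p, k) \<in> gadget_edges" "r = gadget_masks ! g p" using sel[OF r] by blast
    then show ?thesis using g(2)[of p k] g(1)[of p] k gadget_mask_nth(2)[of "g p" "g k"] by simp
  qed
  then have "gadget_masks ! g k \<in> set (select ?c gadget_masks)"
    using fold k(2) length_gadget_masks by (intro in_select) simp_all
  then have "only_identity gadget_masks (drop (Suc k) earlier_masks) (gadget_masks ! g k # ?xs)"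
    using step.prems unfolding drop by (simp add: list_all_iff)
  then show ?case using step.IH by simp
qed

lemma gadget_search: "only_identity gadget_masks earlier_masks []"
  by code_simp

text \<open>The search sees images only as rows of the matrix; distinct rows allow the vertices to
  be recovered.\<close>

lemma gadget_masks_distinct: "distinct gadget_masks"
  by code_simp

lemma gadget_edges_iff: "(p, q) \<in> gadget_edges \<longleftrightarrow> p < 21 \<and> q \<in> set (gadget_rows ! p)"
  by (simp add: gadget_edges_def)

text \<open>The finite conditions of \<open>gadget\<close> in executable form: symmetry, no loops,
  independence of the vertices from 10 on and a complete graph on four vertices over every edge;
  then the stacking of triangles.\<close>

lemma gadget_edges_checks:
  "list_all (\<lambda>p. list_all (\<lambda>q. q < 21 \<and> p \<in> set (gadget_rows ! q) \<and> p \<noteq> q \<and> (p < 10 \<or> q < 10) \<and>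
     list_ex (\<lambda>r. r \<in> set (gadget_rows ! q) \<and>
       list_ex (\<lambda>s. s \<in> set (gadget_rows ! q) \<and> s \<in> set (gadget_rows ! r)) (gadget_rows ! p))
     (gadget_rows ! p)) (gadget_rows ! p)) [0..<21]"
  "list_all (\<lambda>k. list_ex (\<lambda>i. i < k \<and>
     list_ex (\<lambda>j. j < k \<and> j \<in> set (gadget_rows ! i)) (gadget_rows ! k)) (gadget_rows ! k)) [2..<21]"
  "1 \<in> set (gadget_rows ! 0)"
  by code_simp+

lemma gadget_edgeD:
  assumes "(p, q) \<in> gadget_edges"
  shows "p < 21" "q < 21" "(q, p) \<in> gadget_edges" "p \<noteq> q" "p < 10 \<or> q < 10"
    "\<exists>r s. {(p, r), (p, s), (q, r), (q, s), (r, s)} \<subseteq> gadget_edges"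
proof -
  have pq: "p < 21" "q \<in> set (gadget_rows ! p)" using assms by (auto simp: gadget_edges_def)
  have *: "q' < 21 \<and> p \<in> set (gadget_rows ! q') \<and> p \<noteq> q' \<and> (p < 10 \<or> q' < 10) \<and>
      (\<exists>r\<in>set (gadget_rows ! p). r \<in> set (gadget_rows ! q') \<and>
        (\<exists>s\<in>set (gadget_rows ! p). s \<in> set (gadget_rows ! q') \<and> s \<in> set (gadget_rows ! r)))"
    if "q' \<in> set (gadget_rows ! p)" for q'
  proof -
    have "p \<in> set [0..<21]" using pq(1) by (simp del: upt_rec_numeral)
    from bspec[OF bspec[OF gadget_edges_checks(1)[unfolded list_all_iff list_ex_iff] this] that]
    show ?thesis .
  qed
  note q = *[OF pq(2)]
  from q obtain r s where rs: "r \<in> set (gadget_rows ! p)" "r \<in> set (gadget_rows ! q)"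
    "s \<in> set (gadget_rows ! p)" "s \<in> set (gadget_rows ! q)" "s \<in> set (gadget_rows ! r)" by blast
  show "p < 21" "q < 21" "(q, p) \<in> gadget_edges" "p \<noteq> q" "p < 10 \<or> q < 10"
    using pq q by (auto simp: gadget_edges_def)
  show "\<exists>r s. {(p, r), (p, s), (q, r), (q, s), (r, s)} \<subseteq> gadget_edges"
    using rs pq q *[OF rs(1)] by (intro exI[of _ r] exI[of _ s]) (simp add: gadget_edges_def)
qed

lemma gadget_rigid:
  assumes g: "\<And>p. p < 21 \<Longrightarrow> g p < 21" "\<And>p q. (p, q) \<in> gadget_edges \<Longrightarrow> (g p, g q) \<in> gadget_edges"
    and p: "p < 21"
  shows "g p = p"
proof -
  have "sym gadget_edges" using gadget_edgeD(3) by (auto intro: symI)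
  then have "map (\<lambda>p. gadget_masks ! g p) (rev [0..<21]) = rev gadget_masks"
    using only_identity_sound[of 0 g] gadget_search g by simp
  then have "map (\<lambda>p. gadget_masks ! g p) [0..<21] = gadget_masks"
    by (simp only: rev_map[symmetric] rev_is_rev_conv)
  then have "gadget_masks ! g p = gadget_masks ! p"
    using p by (metis (no_types, lifting) add_0 diff_zero length_upt nth_map nth_upt)
  then show ?thesis
    using gadget_masks_distinct g(1)[OF p] p length_gadget_masks by (simp add: nth_eq_iff_index_eq)
qed

section \<open>The embedding\<close>

interpretation rigid_gadget: gadget 21 gadget_edges "{10..20}" positions
proof
  show "sym gadget_edges" using gadget_edgeD(3) by (auto intro: symI)
  show "irrefl gadget_edges" using gadget_edgeD(4) by (auto intro: irreflI)
  show "p < 21 \<and> q < 21" if "(p, q) \<in> gadget_edges" for p q using gadget_edgeD(1,2)[OF that] by simp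
  show "p < 21" if "p \<in> {10..20}" for p :: nat using that by simp
  show "p \<notin> {10..20} \<or> q \<notin> {10..20}" if "(p, q) \<in> gadget_edges" for p q
    using gadget_edgeD(5)[OF that] by auto
  show "(0, 1) \<in> gadget_edges" using gadget_edges_checks(3) by (simp add: gadget_edges_iff)
  show "\<exists>i<k. \<exists>j<k. {(i, j), (i, k), (j, k)} \<subseteq> gadget_edges" if k: "2 \<le> k" "k < 21" for k
  proof -
    have "\<exists>i\<in>set (gadget_rows ! k). i < k \<and> (\<exists>j\<in>set (gadget_rows ! k). j < k \<and> j \<in> set (gadget_rows ! i))"
    proof -
      have "k \<in> set [2..<21]" using k by (simp del: upt_rec_numeral)
      from bspec[OF gadget_edges_checks(2)[unfolded list_all_iff list_ex_iff] this] show ?thesis .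
    qed
    then obtain i j where ij: "i \<in> set (gadget_rows ! k)" "i < k" "j \<in> set (gadget_rows ! k)" "j < k"
      "j \<in> set (gadget_rows ! i)" by blast
    then have "(i, j) \<in> gadget_edges" "(k, i) \<in> gadget_edges" "(k, j) \<in> gadget_edges"
      using k by (simp_all add: gadget_edges_iff)
    then show ?thesis using gadget_edgeD(3) ij by blast
  qed
  show "\<exists>r s. {(p, r), (p, s), (q, r), (q, s), (r, s)} \<subseteq> gadget_edges" if "(p, q) \<in> gadget_edges" for p q
    using gadget_edgeD(6)[OF that] .
  show "g p = p" if "\<And>p. p < 21 \<Longrightarrow> g p < 21" "\<And>p q. (p, q) \<in> gadget_edges \<Longrightarrow> (g p, g q) \<in> gadget_edges"
    "p < 21" for g p using gadget_rigid[OF that] .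
  show "A = B" if "A \<in> positions" "B \<in> positions" "A \<subseteq> B" for A B
    using that unfolding positions_def by (elim insertE emptyE) simp_all
qed

context algebra_encoding
begin

definition algebra_graph where
  "algebra_graph r A = subdivision r (glue 21 gadget_edges (encoding A))"

text \<open>This vertex does not depend on the algebra, as required of \<open>tag\<close> in
  \<open>full_embedding_of_representation\<close>.\<close>

definition mark where
  "mark a = (Elem (Carrier a) :: ('u, ('u \<times> 'u option) option) element gvertex,
    Elem (Carrier a) :: ('u, ('u \<times> 'u option) option) element gvertex, 0 :: nat)"

lemma inj_mark: "inj mark"
  by (auto simp: mark_def inj_def)

lemma graph_glue_encoding: "algebra \<Delta> A \<Longrightarrow> graph (glue 21 gadget_edges (encoding A))"
  by (rule rigid_gadget.graph_glue[OF gluable_encoding])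

lemma graph_algebra_graph: "algebra \<Delta> A \<Longrightarrow> graph (algebra_graph r A)"
  unfolding algebra_graph_def by (rule graph_subdivision[OF graph_glue_encoding])

lemma verts_glue_cases:
  assumes "x \<in> verts (glue N E D)"
  obtains v where "v \<in> elems D" "x = Elem v" | \<tau> p where "\<tau> \<in> tuples D" "p < N" "x = loc \<tau> p"
  using assms by (auto simp: glue_def)

lemma mark_in_verts:
  assumes A: "algebra \<Delta> A"
  shows "mark a \<in> verts (algebra_graph r A) \<longleftrightarrow> a \<in> carrier A"
proof
  assume "a \<in> carrier A"
  then show "mark a \<in> verts (algebra_graph r A)"
    by (simp add: algebra_graph_def mark_def subdivision_def glue_def encoding_elems_def)
next
  assume "mark a \<in> verts (algebra_graph r A)"
  then have "Elem (Carrier a) \<in> verts (glue 21 gadget_edges (encoding A))"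
    unfolding algebra_graph_def mark_def
  proof (cases rule: verts_subdivision_cases[OF graph_glue_encoding[OF A], consumes 1])
    case (2 x y i)
    then show ?thesis
      using pt_eq_branch[OF 2(4)[symmetric] edge_distinct[OF graph_glue_encoding[OF A] 2(1)]] by simp
  qed simp
  then have "Carrier a \<in> elems (encoding A)"
  proof (cases rule: verts_glue_cases)
    case (2 \<tau> p)
    then have "\<tau> p = Some (Carrier a)" by (metis loc_eq_Elem)
    then show ?thesis using rigid_gadget.tuple_elem[OF gluable_encoding[OF A] 2(1)] by blast
  qed simp
  then show "a \<in> carrier A" by (auto simp: encoding_elems_def)
qed

text \<open>Undoes subdivision, gluing and encoding in turn. All layers stay visible because
  uniqueness needs each of them.\<close>

lemma algebra_graph_hom:
  assumes A: "algebra \<Delta> A" and B: "algebra \<Delta> B" and r: "1 \<le> r"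
    and F: "F \<in> graph_homs (algebra_graph r A) (algebra_graph r B)"
  obtains f g h where
    "\<And>x y i. (x, y, i) \<in> verts (algebra_graph r A) \<Longrightarrow> F (x, y, i) = (f x, f y, i)"
    "\<And>v. v \<in> elems (encoding A) \<Longrightarrow> f (Elem v) = Elem (g v)"
    "\<And>\<tau> p. \<tau> \<in> tuples (encoding A) \<Longrightarrow> p < 21 \<Longrightarrow> f (loc \<tau> p) = loc (map_option g \<circ> \<tau>) p"
    "g \<in> system_homs (encoding A) (encoding B)"
    "h \<in> algebra_homs \<Delta> A B" "\<And>a. a \<in> carrier A \<Longrightarrow> g (Carrier a) = Carrier (h a)"
    "\<And>s x. s \<in> symbols \<Delta> \<Longrightarrow> x \<in> arity \<Delta> s \<rightarrow>\<^sub>E carrier A \<Longrightarrow> g (Term s x) = Term s (compose (arity \<Delta> s) h x)"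
    "\<And>w. w \<in> W \<Longrightarrow> g (Point w) = Point w"
proof -
  note GA = gluable_encoding[OF A] and GB = gluable_encoding[OF B]
  obtain f where f: "f \<in> graph_homs (glue 21 gadget_edges (encoding A)) (glue 21 gadget_edges (encoding B))"
    "\<And>x y i. (x, y, i) \<in> verts (algebra_graph r A) \<Longrightarrow> F (x, y, i) = (f x, f y, i)"
    using subdivision_hom[OF graph_glue_encoding[OF A] graph_glue_encoding[OF B]
        F[unfolded algebra_graph_def] rigid_gadget.K4_covered_glue[OF GA] r]
    unfolding algebra_graph_def by metis
  obtain g where g: "g \<in> system_homs (encoding A) (encoding B)"
    "\<And>v. v \<in> elems (encoding A) \<Longrightarrow> f (Elem v) = Elem (g v)"
    "\<And>\<tau> p. \<tau> \<in> tuples (encoding A) \<Longrightarrow> p < 21 \<Longrightarrow> f (loc \<tau> p) = loc (map_option g \<circ> \<tau>) p"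
    using rigid_gadget.glue_hom[OF GA GB f(1)] by metis
  obtain h where "h \<in> algebra_homs \<Delta> A B" "\<And>a. a \<in> carrier A \<Longrightarrow> g (Carrier a) = Carrier (h a)"
    "\<And>s x. s \<in> symbols \<Delta> \<Longrightarrow> x \<in> arity \<Delta> s \<rightarrow>\<^sub>E carrier A \<Longrightarrow> g (Term s x) = Term s (compose (arity \<Delta> s) h x)"
    "\<And>w. w \<in> W \<Longrightarrow> g (Point w) = Point w"
    using encoding_hom[OF A g(1)] by metis
  with f(2) g show thesis by (intro that[of f g h])
qed

lemma algebra_graph_hom_mark:
  assumes A: "algebra \<Delta> A" and B: "algebra \<Delta> B" and r: "1 \<le> r"
    and F: "F \<in> graph_homs (algebra_graph r A) (algebra_graph r B)"
  shows "\<exists>h\<in>algebra_homs \<Delta> A B. \<forall>a\<in>carrier A. F (mark a) = mark (h a)"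
proof -
  obtain f g h where *: "\<And>x y i. (x, y, i) \<in> verts (algebra_graph r A) \<Longrightarrow> F (x, y, i) = (f x, f y, i)"
    "\<And>v. v \<in> elems (encoding A) \<Longrightarrow> f (Elem v) = Elem (g v)"
    "h \<in> algebra_homs \<Delta> A B" "\<And>a. a \<in> carrier A \<Longrightarrow> g (Carrier a) = Carrier (h a)"
    by (rule algebra_graph_hom[OF assms], rule that)
  have "F (mark a) = mark (h a)" if a: "a \<in> carrier A" for a
  proof -
    have "Carrier a \<in> elems (encoding A)" using a by (simp add: encoding_elems_def)
    then show ?thesis
      using *(1)[of "Elem (Carrier a)" "Elem (Carrier a)" 0] *(2,4) a mark_in_verts[OF A, of a r]
      by (simp add: mark_def)
  qed
  with *(3) show ?thesis by blast
qed

text \<open>Marked vertices determine \<open>h\<close>; \<open>h\<close> determines \<open>g\<close>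
  on carrier and terms, while points are fixed; \<open>g\<close> determines \<open>f\<close>, and
  \<open>f\<close> determines \<open>F\<close>.\<close>

lemma algebra_graph_hom_unique:
  assumes A: "algebra \<Delta> A" and B: "algebra \<Delta> B" and r: "1 \<le> r"
    and F: "F \<in> graph_homs (algebra_graph r A) (algebra_graph r B)"
    and F': "F' \<in> graph_homs (algebra_graph r A) (algebra_graph r B)"
    and eq: "\<And>a. a \<in> carrier A \<Longrightarrow> F (mark a) = F' (mark a)"
  shows "F = F'"
proof -
  obtain f g h where hom: "\<And>x y i. (x, y, i) \<in> verts (algebra_graph r A) \<Longrightarrow> F (x, y, i) = (f x, f y, i)"
    "\<And>v. v \<in> elems (encoding A) \<Longrightarrow> f (Elem v) = Elem (g v)"
    "\<And>\<tau> p. \<tau> \<in> tuples (encoding A) \<Longrightarrow> p < 21 \<Longrightarrow> f (loc \<tau> p) = loc (map_option g \<circ> \<tau>) p"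
    "g \<in> system_homs (encoding A) (encoding B)"
    "h \<in> algebra_homs \<Delta> A B" "\<And>a. a \<in> carrier A \<Longrightarrow> g (Carrier a) = Carrier (h a)"
    "\<And>s x. s \<in> symbols \<Delta> \<Longrightarrow> x \<in> arity \<Delta> s \<rightarrow>\<^sub>E carrier A \<Longrightarrow> g (Term s x) = Term s (compose (arity \<Delta> s) h x)"
    "\<And>w. w \<in> W \<Longrightarrow> g (Point w) = Point w"
    by (rule algebra_graph_hom[OF A B r F], rule that)
  obtain f' g' h' where hom': "\<And>x y i. (x, y, i) \<in> verts (algebra_graph r A) \<Longrightarrow> F' (x, y, i) = (f' x, f' y, i)"
    "\<And>v. v \<in> elems (encoding A) \<Longrightarrow> f' (Elem v) = Elem (g' v)"
    "\<And>\<tau> p. \<tau> \<in> tuples (encoding A) \<Longrightarrow> p < 21 \<Longrightarrow> f' (loc \<tau> p) = loc (map_option g' \<circ> \<tau>) p"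
    "g' \<in> system_homs (encoding A) (encoding B)"
    "h' \<in> algebra_homs \<Delta> A B" "\<And>a. a \<in> carrier A \<Longrightarrow> g' (Carrier a) = Carrier (h' a)"
    "\<And>s x. s \<in> symbols \<Delta> \<Longrightarrow> x \<in> arity \<Delta> s \<rightarrow>\<^sub>E carrier A \<Longrightarrow> g' (Term s x) = Term s (compose (arity \<Delta> s) h' x)"
    "\<And>w. w \<in> W \<Longrightarrow> g' (Point w) = Point w"
    by (rule algebra_graph_hom[OF A B r F'], rule that)
  have "h a = h' a" if a: "a \<in> carrier A" for a
  proof -
    have "Carrier a \<in> elems (encoding A)" "(Elem (Carrier a), Elem (Carrier a), 0) \<in> verts (algebra_graph r A)"
      using a mark_in_verts[OF A, of a r] by (simp_all add: encoding_elems_def mark_def)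
    then show ?thesis using eq[OF a] hom(1,2,6) hom'(1,2,6) a by (simp add: mark_def)
  qed
  moreover have "h \<in> carrier A \<rightarrow>\<^sub>E carrier B" "h' \<in> carrier A \<rightarrow>\<^sub>E carrier B"
    using hom(5) hom'(5) by (auto simp: algebra_homs_def)
  ultimately have "h = h'" by (intro PiE_ext)
  then have g: "g v = g' v" if "v \<in> elems (encoding A)" for v
    using that hom(6-8) hom'(6-8) by (auto simp: encoding_elems_def)
  have f: "f x = f' x" if "x \<in> verts (glue 21 gadget_edges (encoding A))" for x
    using that
  proof (cases rule: verts_glue_cases)
    case (1 v)
    then show ?thesis using hom(2) hom'(2) g by simp
  next
    case (2 \<tau> p)
    have "ran \<tau> \<subseteq> elems (encoding A)" using gluable_encoding[OF A] 2(1) by (simp add: gluable_def)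
    then have "map_option g (\<tau> q) = map_option g' (\<tau> q)" for q
      using g by (cases "\<tau> q") (auto simp: ran_def)
    then have "map_option g \<circ> \<tau> = map_option g' \<circ> \<tau>" by auto
    then show ?thesis using 2 hom(3) hom'(3) by simp
  qed
  have "F p = F' p" if p: "p \<in> verts (algebra_graph r A)" for p
  proof -
    obtain x y i where xyi: "p = (x, y, i)" by (cases p)
    have "x \<in> verts (glue 21 gadget_edges (encoding A))" "y \<in> verts (glue 21 gadget_edges (encoding A))"
      using verts_subdivision_subset[OF graph_glue_encoding[OF A], of r] p xyi
      by (auto simp: algebra_graph_def)
    then show ?thesis
      using hom(1)[of x y i] hom'(1)[of x y i] f[of x] f[of y] p xyi by simp
  qed
  moreover have "F \<in> verts (algebra_graph r A) \<rightarrow>\<^sub>E verts (algebra_graph r B)"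
    "F' \<in> verts (algebra_graph r A) \<rightarrow>\<^sub>E verts (algebra_graph r B)"
    using F F' by (auto simp: graph_homs_def)
  ultimately show ?thesis by (intro PiE_ext)
qed

lemma algebra_graph_lift:
  assumes A: "algebra \<Delta> A" and h: "h \<in> algebra_homs \<Delta> A B"
  shows "\<exists>F\<in>graph_homs (algebra_graph r A) (algebra_graph r B). \<forall>a\<in>carrier A. F (mark a) = mark (h a)"
proof -
  obtain g where g: "g \<in> system_homs (encoding A) (encoding B)"
    "\<And>a. a \<in> carrier A \<Longrightarrow> g (Carrier a) = Carrier (h a)"
    using encoding_lift[OF h A] by metis
  note F = subdivision_lift[OF rigid_gadget.glue_lift[OF gluable_encoding[OF A] g(1)] graph_glue_encoding[OF A],
      folded algebra_graph_def]
  show ?thesis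
  proof (rule bexI[OF _ F], rule ballI)
    fix a assume a: "a \<in> carrier A"
    then have "Elem (Carrier a) \<in> verts (glue 21 gadget_edges (encoding A))"
      "(Elem (Carrier a), Elem (Carrier a), 0) \<in> verts (algebra_graph r A)"
      using mark_in_verts[OF A, of a r] by (simp_all add: glue_def encoding_elems_def mark_def)
    then show "(\<lambda>(x, y, i)\<in>verts (algebra_graph r A).
        (restrict (\<lambda>x. case x of Elem v \<Rightarrow> Elem (g v) | Inner \<tau> p \<Rightarrow> Inner (map_option g \<circ> \<tau>) p)
            (verts (glue 21 gadget_edges (encoding A))) x,
         restrict (\<lambda>x. case x of Elem v \<Rightarrow> Elem (g v) | Inner \<tau> p \<Rightarrow> Inner (map_option g \<circ> \<tau>) p)
            (verts (glue 21 gadget_edges (encoding A))) y, i)) (mark a) = mark (h a)"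
      using g(2)[OF a] by (simp add: mark_def)
  qed
qed

text \<open>A single limit already embeds the natural numbers into \<open>W\<close> by its ladder,
  so they are small. If only finite sets are small, there are no limits.\<close>

lemma card_limits:
  assumes inf: "infinite (UNIV :: 'u set)" and W: "|W| <o |UNIV :: 'u set|"
  shows "|limits \<times> (UNIV :: nat set)| <o |UNIV :: 'u set|"
proof (cases "limits = {}")
  case True
  then show ?thesis by (intro ordLess_finite[OF inf]) simp
next
  case False
  then obtain e where e: "e \<in> limits" by blast
  have "inj (ladder e)" "range (ladder e) \<subseteq> W"
    using increasing_inj[of "ladder e"] ladder_in_W[OF e] by (auto intro!: injI)
  then have "|UNIV :: nat set| <o |UNIV :: 'u set|"
    using W card_of_ordLeq[of UNIV W] ordLeq_ordLess_trans by blast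
  moreover have "|limits| <o |UNIV :: 'u set|"
    by (rule ordLess_subset[OF _ W]) (auto simp: limits_def)
  ultimately show ?thesis by (intro ordLess_Times[OF inf])
qed

lemma card_algebra_graph:
  assumes inf: "infinite (UNIV :: 'u set)" and W: "|W| <o |UNIV :: 'u set|"
    and \<Delta>: "algebra_type \<Delta>" and A: "algebra \<Delta> A" and small: "small (carrier A)"
  shows "|verts (algebra_graph r A)| <o |UNIV :: 'u set|"
proof -
  note Un = card_of_Un_ordLess_infinite[OF inf] and Times = ordLess_Times[OF inf]
    and fin = ordLess_finite[OF inf]
  let ?T = "SIGMA s:symbols \<Delta>. arity \<Delta> s \<rightarrow>\<^sub>E carrier A"
  have T: "|?T| <o |UNIV :: 'u set|" using \<Delta> small by (auto simp: algebra_type_def)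
  have C: "|carrier A| <o |UNIV :: 'u set|" using small by (simp add: small_def)
  have "encoding_elems A \<subseteq> Carrier ` carrier A \<union> (\<lambda>(s, x). Term s x) ` ?T \<union> Point ` W"
    by (auto simp: encoding_elems_def)
  then have elems: "|encoding_elems A| <o |UNIV :: 'u set|"
    by (rule ordLess_subset) (intro Un ordLess_image C T W)
  \<comment> \<open>An overestimate that pairs every term with every label; what it yields for
    unsuitable labels is irrelevant.\<close>
  let ?term = "\<lambda>((s, x), l). [12 \<mapsto> Term s x,
    13 \<mapsto> Carrier (case snd (the l) of Some i \<Rightarrow> x i | None \<Rightarrow> operation A s x), 14 \<mapsto> Point l]"
  let ?order = "\<lambda>(u, v). [15 \<mapsto> Point u, 16 \<mapsto> Point v]"
  let ?ladder = "\<lambda>(e, n). [17 \<mapsto> Point e, 18 \<mapsto> Point (ladder e n), 19 \<mapsto> Point (ladder e (Suc n))]"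
  have "tuples (encoding A) \<subseteq> (\<lambda>v. [10 \<mapsto> v]) ` encoding_elems A \<union> (\<lambda>a. [11 \<mapsto> Carrier a]) ` carrier A \<union>
      ?term ` (?T \<times> W) \<union> ?order ` (W \<times> W) \<union> ?ladder ` (limits \<times> UNIV) \<union> {[20 \<mapsto> Point bot]}" (is "_ \<subseteq> ?R")
  proof
    fix \<tau> assume "\<tau> \<in> tuples (encoding A)"
    then show "\<tau> \<in> ?R"
    proof (cases rule: encoding_tuple_cases)
      case (3 s x i)
      then have "\<tau> \<in> ?term ` (?T \<times> W)"
        using labels(2) by (intro image_eqI[of _ _ "((s, x), Some (s, Some i))"]) simp_all
      then show ?thesis by simp
    next
      case (4 s x)
      then have "\<tau> \<in> ?term ` (?T \<times> W)"
        using labels(1) by (intro image_eqI[of _ _ "((s, x), Some (s, None))"]) simp_all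
      then show ?thesis by simp
    next
      case (5 u v)
      then have "\<tau> \<in> ?order ` (W \<times> W)" by (intro image_eqI[of _ _ "(u, v)"]) simp_all
      then show ?thesis by simp
    next
      case (6 e n)
      then have "\<tau> \<in> ?ladder ` (limits \<times> UNIV)" by (intro image_eqI[of _ _ "(e, n)"]) simp_all
      then show ?thesis by simp
    qed simp_all
  qed
  then have tuples: "|tuples (encoding A)| <o |UNIV :: 'u set|"
    by (rule ordLess_subset) (intro Un ordLess_image Times elems C T W card_limits inf fin finite.intros)
  let ?V = "verts (glue 21 gadget_edges (encoding A))"
  have "?V \<subseteq> Elem ` encoding_elems A \<union> (\<lambda>(\<tau>, p). loc \<tau> p) ` (tuples (encoding A) \<times> {..<21})"
    by (auto simp: glue_def)
  then have V: "|?V| <o |UNIV :: 'u set|"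
    by (rule ordLess_subset) (intro Un ordLess_image Times elems tuples fin finite_lessThan)
  show ?thesis
    unfolding algebra_graph_def
    by (rule ordLess_subset[OF verts_subdivision_subset[OF graph_glue_encoding[OF A]]])
      (intro Times V fin finite_atMost)
qed

end

text \<open>The labels with first component \<open>s\<close> are encoded by families of arity \<open>arity \<Delta> s\<close> in a two-element set.\<close>

lemma ordLess_labels:
  fixes \<Delta> :: "'u algebra_type"
  assumes inf: "infinite (UNIV :: 'u set)" and \<Delta>: "algebra_type \<Delta>"
  shows "|SIGMA s:symbols \<Delta>. insert None (Some ` arity \<Delta> s)| <o |UNIV :: 'u set|"
proof -
  obtain u0 :: 'u where "u0 \<in> UNIV" by blast
  obtain u1 :: 'u where "u1 \<notin> {u0}" using ex_new_if_finite[OF inf, of "{u0}"] by auto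
  then have u: "u1 \<noteq> u0" by simp
  let ?S = "SIGMA s:symbols \<Delta>. arity \<Delta> s \<rightarrow>\<^sub>E {u0, u1}"
  \<comment> \<open>The constant family codes \<open>None\<close> and the indicator of
    \<open>i\<close> codes \<open>Some i\<close>. If the universe has singular cardinality, a small
    union of small arities may be large, so the bound is taken from the condition on argument
    families.\<close>
  define c where "c = (\<lambda>(s, x). (s, if \<forall>i\<in>arity \<Delta> s. x i = u0 then None
    else Some (SOME i. i \<in> arity \<Delta> s \<and> x i = u1)))"
  have "small {u0, u1}" unfolding small_def by (intro ordLess_finite[OF inf]) simp
  then have "|?S| <o |UNIV :: 'u set|" using \<Delta> by (auto simp: algebra_type_def)
  then have S: "|c ` ?S| <o |UNIV :: 'u set|" by (rule ordLess_image)
  show ?thesis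
  proof (rule ordLess_subset[OF _ S], rule subsetI)
    fix l assume "l \<in> (SIGMA s:symbols \<Delta>. insert None (Some ` arity \<Delta> s))"
    then consider s where "s \<in> symbols \<Delta>" "l = (s, None)"
      | s i where "s \<in> symbols \<Delta>" "i \<in> arity \<Delta> s" "l = (s, Some i)" by auto
    then show "l \<in> c ` ?S"
    proof cases
      case (1 s)
      have "c (s, \<lambda>j\<in>arity \<Delta> s. u0) = l" using 1 by (simp add: c_def)
      moreover have "(s, \<lambda>j\<in>arity \<Delta> s. u0) \<in> ?S" using 1 by auto
      ultimately show ?thesis by (metis imageI)
    next
      case (2 s i)
      let ?x = "\<lambda>j\<in>arity \<Delta> s. if j = i then u1 else u0"
      have "(SOME j. j \<in> arity \<Delta> s \<and> ?x j = u1) = i"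
        by (rule some_equality) (use 2 u in \<open>auto split: if_splits\<close>)
      moreover have "\<not> (\<forall>j\<in>arity \<Delta> s. ?x j = u0)" using 2 u by auto
      ultimately have "c (s, ?x) = l" using 2 by (simp only: c_def prod.case if_False)
      moreover have "(s, ?x) \<in> ?S" using 2 by auto
      ultimately show ?thesis by (metis imageI)
    qed
  qed
qed

lemma Alg_full_embedding:
  fixes \<Delta> :: "'u algebra_type" and G :: "'v graph"
  assumes inf: "infinite (UNIV :: 'u set)" and \<Delta>: "algebra_type \<Delta>"
    and G: "graph G" "\<not> bipartite G"
  shows "\<exists>F F'. full_embedding (Alg \<Delta>) (Gra_to G :: ('u graph, 'u \<Rightarrow> 'u) category) F F'"
proof -
  obtain v n where n: "odd n" "(v, v) \<in> edges G ^^ n"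
    using odd_closed_walk_if_not_bipartite[OF G] by blast
  then obtain r where r: "n = 2 * r + 1" by (auto elim: oddE)
  have "r \<noteq> 0"
  proof
    assume "r = 0"
    then have "(v, v) \<in> edges G" using n r by auto
    then show False using G(1) by (auto simp: graph_def irrefl_def)
  qed
  then have r1: "1 \<le> r" by simp
  define L where "L = (SIGMA s:symbols \<Delta>. insert None (Some ` arity \<Delta> s))"
  obtain less and bot where "well_ordered_set (insert None (Some ` L)) less bot None"
    using well_ordered_set_Some by blast
  then interpret algebra_encoding "insert None (Some ` L)" less bot None \<Delta>
    by (auto simp: algebra_encoding_def algebra_encoding_axioms_def L_def)
  have L: "|L| <o |UNIV :: 'u set|"
    unfolding L_def using inf \<Delta> by (rule ordLess_labels)
  have "|{None} \<union> Some ` L| <o |UNIV :: 'u set|"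
    by (intro card_of_Un_ordLess_infinite[OF inf] ordLess_finite[OF inf] ordLess_image L) simp
  then have W: "|insert None (Some ` L)| <o |UNIV :: 'u set|" by simp
  have alg: "algebra \<Delta> A" "small (carrier A)" if "A \<in> Obj (Alg \<Delta>)" for A using that by (auto simp: Alg_def)
  \<comment> \<open>Two disjoint copies of \<open>'u\<close> inside \<open>'u\<close>: the left one
    receives the marked vertices, uniformly in the algebra; the right one all other vertices, by an
    injection chosen for each algebra.\<close>
  have "|(UNIV :: 'u set) <+> (UNIV :: 'u set)| =o |UNIV :: 'u set|"
    using card_of_Plus_infinite[OF inf, of "UNIV :: 'u set"] by (simp add: card_of_refl ordIso_imp_ordLeq)
  then obtain b :: "'u + 'u \<Rightarrow> 'u" where "bij_betw b (UNIV <+> UNIV) UNIV"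
    unfolding card_of_ordIso[symmetric] by (elim exE)
  then have b: "inj b" by (simp add: bij_betw_def)
  have "\<forall>A\<in>Obj (Alg \<Delta>). \<exists>j :: _ \<Rightarrow> 'u. inj_on j (verts (algebra_graph r A))"
  proof
    fix A assume "A \<in> Obj (Alg \<Delta>)"
    then have "|verts (algebra_graph r A)| \<le>o |UNIV :: 'u set|"
      using card_algebra_graph[OF inf W \<Delta> alg] by (intro ordLess_imp_ordLeq) auto
    then show "\<exists>j :: _ \<Rightarrow> 'u. inj_on j (verts (algebra_graph r A))"
      unfolding card_of_ordLeq[symmetric] by blast
  qed
  from bchoice[OF this] obtain j :: "_ \<Rightarrow> _ \<Rightarrow> 'u" where
    j: "\<forall>A\<in>Obj (Alg \<Delta>). inj_on (j A) (verts (algebra_graph r A))" by (elim exE)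
  define e where "e A x = (if x \<in> range mark then b (Inl (inv mark x)) else b (Inr (j A x)))" for A x
  have e_mark: "e A (mark a) = b (Inl a)" for A a by (simp add: e_def inj_mark)
  have e_tag: "e A x = b (Inl a) \<Longrightarrow> x = mark a" for A x a
    using inv_f_f[OF inj_mark] by (auto simp: e_def inj_eq[OF b] split: if_splits)
  have e_inj: "inj_on (e A) (verts (algebra_graph r A))" if "A \<in> Obj (Alg \<Delta>)" for A
  proof (rule inj_onI)
    fix x y assume xy: "x \<in> verts (algebra_graph r A)" "y \<in> verts (algebra_graph r A)" "e A x = e A y"
    show "x = y"
    proof (cases "x \<in> range mark")
      case True
      then show ?thesis using xy(3) e_mark e_tag by (metis rangeE)
    next
      case False
      then have "y \<notin> range mark" using xy(3) e_mark e_tag by (metis rangeE rangeI)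
      then have "j A x = j A y" using False xy(3) by (simp add: e_def inj_eq[OF b])
      then show ?thesis using xy inj_onD[OF bspec[OF j that]] by blast
    qed
  qed
  define \<Gamma> where "\<Gamma> A = map_graph (e A) (algebra_graph r A)" for A
  have "\<exists>F'. full_embedding (Alg \<Delta>) (Gra_to G) \<Gamma> F'"
  proof (rule full_embedding_of_representation[of "\<lambda>a. b (Inl a)"])
    show "inj (\<lambda>a. b (Inl a))" using b by (auto simp: inj_def)
    show "\<Gamma> A \<in> Obj (Gra_to G)" if A: "A \<in> Obj (Alg \<Delta>)" for A
    proof -
      obtain c where c: "c \<in> graph_homs (algebra_graph r A) G"
        using subdivision_to_closed_walk[OF graph_glue_encoding[OF alg(1)[OF A]] G(1) n(2)[unfolded r]]
        unfolding algebra_graph_def by blast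
      \<comment> \<open>Lets the transport lemma for homomorphisms apply although the target
        \<open>G\<close> is not moved.\<close>
      have "map_graph id G = G" by (simp add: map_graph_def prod.map_id0)
      then have "graph_homs (\<Gamma> A) G \<noteq> {}"
        using graph_homs_map_graphI[OF graph_algebra_graph[OF alg(1)[OF A]] e_inj[OF A] c, of id]
        unfolding \<Gamma>_def by (metis empty_iff)
      moreover have "small (verts (\<Gamma> A))"
        using ordLess_image[OF card_algebra_graph[OF inf W \<Delta> alg[OF A]]] by (simp add: \<Gamma>_def map_graph_def small_def)
      moreover have "graph (\<Gamma> A)"
        unfolding \<Gamma>_def by (rule graph_map_graph[OF graph_algebra_graph[OF alg(1)[OF A]] e_inj[OF A]])
      ultimately show ?thesis by (simp add: Gra_to_def full_subcategory_def Gra_def)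
    qed
    show "b (Inl a) \<in> verts (\<Gamma> A) \<longleftrightarrow> a \<in> carrier A" if A: "A \<in> Obj (Alg \<Delta>)" for A a
    proof
      assume "b (Inl a) \<in> verts (\<Gamma> A)"
      then obtain x where x: "x \<in> verts (algebra_graph r A)" "e A x = b (Inl a)"
        by (auto simp: \<Gamma>_def map_graph_def)
      then show "a \<in> carrier A" using e_tag[OF x(2)] mark_in_verts[OF alg(1)[OF A]] by simp
    next
      assume "a \<in> carrier A"
      then have "e A (mark a) \<in> verts (\<Gamma> A)"
        using mark_in_verts[OF alg(1)[OF A]] by (simp add: \<Gamma>_def map_graph_def)
      then show "b (Inl a) \<in> verts (\<Gamma> A)" by (simp add: e_mark)
    qed
    fix A B assume A: "A \<in> Obj (Alg \<Delta>)" and B: "B \<in> Obj (Alg \<Delta>)"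
    note gA = graph_algebra_graph[OF alg(1)[OF A], of r] and gB = graph_algebra_graph[OF alg(1)[OF B], of r]
    show "\<exists>h\<in>algebra_homs \<Delta> A B. \<forall>a\<in>carrier A. F (b (Inl a)) = b (Inl (h a))"
      if F: "F \<in> graph_homs (\<Gamma> A) (\<Gamma> B)" for F
    proof -
      obtain F0 where F0: "F0 \<in> graph_homs (algebra_graph r A) (algebra_graph r B)"
        "\<And>x. x \<in> verts (algebra_graph r A) \<Longrightarrow> F (e A x) = e B (F0 x)"
        using graph_homs_map_graphD[OF gA gB e_inj[OF B] F[unfolded \<Gamma>_def]] by metis
      obtain h where h: "h \<in> algebra_homs \<Delta> A B" "\<forall>a\<in>carrier A. F0 (mark a) = mark (h a)"
        using algebra_graph_hom_mark[OF alg(1)[OF A] alg(1)[OF B] r1 F0(1)] by (elim bexE)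
      have "F (b (Inl a)) = b (Inl (h a))" if "a \<in> carrier A" for a
        using F0(2)[of "mark a"] h(2) that mark_in_verts[OF alg(1)[OF A]] by (simp add: e_mark)
      then show ?thesis using h(1) by blast
    qed
    show "\<exists>F\<in>graph_homs (\<Gamma> A) (\<Gamma> B). \<forall>a\<in>carrier A. F (b (Inl a)) = b (Inl (h a))"
      if h: "h \<in> algebra_homs \<Delta> A B" for h
    proof -
      obtain F where F: "F \<in> graph_homs (algebra_graph r A) (algebra_graph r B)"
        "\<forall>a\<in>carrier A. F (mark a) = mark (h a)"
        using algebra_graph_lift[OF alg(1)[OF A] h, of r] by (elim bexE)
      obtain F1 where F1: "F1 \<in> graph_homs (\<Gamma> A) (\<Gamma> B)"
        "\<And>x. x \<in> verts (algebra_graph r A) \<Longrightarrow> F1 (e A x) = e B (F x)"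
        using graph_homs_map_graphI[OF gA e_inj[OF A] F(1), of "e B"] unfolding \<Gamma>_def by metis
      have "F1 (b (Inl a)) = b (Inl (h a))" if "a \<in> carrier A" for a
        using F1(2)[of "mark a"] F(2) that mark_in_verts[OF alg(1)[OF A]] by (simp add: e_mark)
      then show ?thesis using F1(1) by blast
    qed
    show "F = F'" if F: "F \<in> graph_homs (\<Gamma> A) (\<Gamma> B)" and F': "F' \<in> graph_homs (\<Gamma> A) (\<Gamma> B)"
      and eq: "\<And>a. a \<in> carrier A \<Longrightarrow> F (b (Inl a)) = F' (b (Inl a))" for F F'
    proof -
      obtain F0 where F0: "F0 \<in> graph_homs (algebra_graph r A) (algebra_graph r B)"
        "\<And>x. x \<in> verts (algebra_graph r A) \<Longrightarrow> F (e A x) = e B (F0 x)"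
        using graph_homs_map_graphD[OF gA gB e_inj[OF B] F[unfolded \<Gamma>_def]] by metis
      obtain F1 where F1: "F1 \<in> graph_homs (algebra_graph r A) (algebra_graph r B)"
        "\<And>x. x \<in> verts (algebra_graph r A) \<Longrightarrow> F' (e A x) = e B (F1 x)"
        using graph_homs_map_graphD[OF gA gB e_inj[OF B] F'[unfolded \<Gamma>_def]] by metis
      have "F0 (mark a) = F1 (mark a)" if a: "a \<in> carrier A" for a
      proof -
        have m: "mark a \<in> verts (algebra_graph r A)" using mark_in_verts[OF alg(1)[OF A]] a by blast
        then have "F0 (mark a) \<in> verts (algebra_graph r B)" "F1 (mark a) \<in> verts (algebra_graph r B)"
          using F0(1) F1(1) by (auto simp: graph_homs_def)
        moreover have "e B (F0 (mark a)) = e B (F1 (mark a))"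
          using eq[OF a] F0(2)[OF m] F1(2)[OF m] by (simp add: e_mark)
        ultimately show ?thesis using inj_onD[OF e_inj[OF B]] by blast
      qed
      then have "F0 = F1" by (rule algebra_graph_hom_unique[OF alg(1)[OF A] alg(1)[OF B] r1 F0(1) F1(1)])
      then have "F y = F' y" if "y \<in> verts (\<Gamma> A)" for y
        using that F0(2) F1(2) by (auto simp: \<Gamma>_def map_graph_def)
      moreover have "F \<in> verts (\<Gamma> A) \<rightarrow>\<^sub>E verts (\<Gamma> B)" "F' \<in> verts (\<Gamma> A) \<rightarrow>\<^sub>E verts (\<Gamma> B)"
        using F F' by (auto simp: graph_homs_def)
      ultimately show ?thesis by (intro PiE_ext)
    qed
  qed
  then show ?thesis by blast
qed

theorem theorem2p8:
  fixes G :: "'v graph"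
  assumes "infinite (UNIV :: 'u set)"
    and "graph G" and "\<not> bipartite G"
  shows "algebraically_universal TYPE('u) TYPE('o) TYPE('m)
           (Gra_to G :: ('u graph, 'u \<Rightarrow> 'u) category)"
proof -
  have "\<exists>F F'. full_embedding C (Gra_to G :: ('u graph, 'u \<Rightarrow> 'u) category) F F'"
    if C: "algebraic_category TYPE('u) C" for C :: "('o, 'm) category"
  proof -
    obtain \<Delta> :: "'u algebra_type" and S where *: "algebra_type \<Delta>" "S \<subseteq> Obj (Alg \<Delta>)"
      "isomorphic_categories C (full_subcategory (Alg \<Delta>) S)"
      using C by (auto simp: algebraic_category_def)
    obtain F F' where "full_embedding (Alg \<Delta>) (Gra_to G :: ('u graph, 'u \<Rightarrow> 'u) category) F F'"
      using Alg_full_embedding[OF assms(1) *(1) assms(2,3)] by blast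
    from full_embedding_after_isomorphism[OF *(3) full_embedding_full_subcategory[OF this *(2)]]
    show ?thesis .
  qed
  then show ?thesis by (simp add: algebraically_universal_def category_Gra_to)
qed

end
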